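(* Let $\varphi\in H^2(\Gamma_w)$ with $\varphi\neq 0$ and $\varphi(D)\cap D\neq\emptyset$. Then the spectrum of the operator $S_z$ on $N_\varphi$ satisfies $$\overline{\varphi(D)\cap D}\subset\sigma(S_z)\subset\overline{\varphi(D)}\cap\overline{D}.$$
   Context: $D$ is the open unit disk, $\Gamma$ the unit circle. $H^2(\Gamma^2)$ is the Hardy space on the torus $\Gamma^2$, identified with holomorphic functions on $D^2$, with coordinate functions $z,w$; $H^2(\Gamma_w)$ is the Hardy space in the variable $w$. For $\varphi\in H^2(\Gamma_w)$, $M_\varphi=[z-\varphi]$ is the closure of $(z-\varphi(w))H^\infty(\Gamma^2)$ in $H^2(\Gamma^2)$, and $N_\varphi=H^2(\Gamma^2)\ominus M_\varphi$ (which is nonzero if and only if $\varphi(D)\cap D\neq\emptyset$). $S_z$ is the compression of multiplication by $z$: $S_zf=P_{N_\varphi}(zf)$ for $f\in N_\varphi$, with $P_{N_\varphi}$ the orthogonal projection onto $N_\varphi$. *)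

theory Defs
  imports "HOL-Complex_Analysis.Complex_Analysis"
begin

text \<open>
  Hardy spaces are realised as spaces of holomorphic functions on the disc, respectively the
  bidisc, with bounded quadratic means over concentric circles, respectively tori.  A function on
  the (bi)disc is encoded as a total function that vanishes outside it, so that equality of
  elements is equality of HOL functions.
\<close>

abbreviation disc :: "complex set"
  where "disc \<equiv> ball 0 1"

abbreviation bidisc :: "(complex \<times> complex) set"
  where "bidisc \<equiv> disc \<times> disc"

definition circle_mean :: "real \<Rightarrow> (complex \<Rightarrow> 'a) \<Rightarrow> 'a::real_normed_vector"
  where "circle_mean r u =
    integral {0..2 * pi} (\<lambda>t. u (of_real r * cis t)) /\<^sub>R (2 * pi)"

definition torus_mean :: "real \<Rightarrow> (complex \<times> complex \<Rightarrow> 'a) \<Rightarrow> 'a::real_normed_vector"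
  where "torus_mean r u =
    integral (cbox (0, 0) (2 * pi, 2 * pi))
      (\<lambda>(s, t). u (of_real r * cis s, of_real r * cis t)) /\<^sub>R (2 * pi)\<^sup>2"

definition holomorphic2_on :: "(complex \<times> complex \<Rightarrow> complex) \<Rightarrow> (complex \<times> complex) set \<Rightarrow> bool"
  where "holomorphic2_on f S \<longleftrightarrow>
    (\<forall>p\<in>S. \<exists>a b. (f has_derivative (\<lambda>(h, k). a * h + b * k)) (at p within S))"

definition hardy2_disc :: "(complex \<Rightarrow> complex) set"
  where "hardy2_disc = {f. f holomorphic_on disc \<and> (\<forall>w. w \<notin> disc \<longrightarrow> f w = 0) \<and>
    bdd_above ((\<lambda>r. circle_mean r (\<lambda>w. (cmod (f w))\<^sup>2)) ` {0<..<1})}"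

definition hardy2 :: "(complex \<times> complex \<Rightarrow> complex) set"
  where "hardy2 = {f. holomorphic2_on f bidisc \<and> (\<forall>p. p \<notin> bidisc \<longrightarrow> f p = 0) \<and>
    bdd_above ((\<lambda>r. torus_mean r (\<lambda>p. (cmod (f p))\<^sup>2)) ` {0<..<1})}"

definition hardy_inf :: "(complex \<times> complex \<Rightarrow> complex) set"
  where "hardy_inf = {f. holomorphic2_on f bidisc \<and> (\<forall>p. p \<notin> bidisc \<longrightarrow> f p = 0) \<and>
    bounded (f ` bidisc)}"

text \<open>
  For elements of \<open>hardy2\<close> the limit exists and equals the inner product of the boundary functions
  in \<open>L\<^sup>2\<close> of the torus with normalised Lebesgue measure.
\<close>

definition h2_inner ::
    "(complex \<times> complex \<Rightarrow> complex) \<Rightarrow> (complex \<times> complex \<Rightarrow> complex) \<Rightarrow> complex"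
  where "h2_inner f g = Lim (at_left 1) (\<lambda>r. torus_mean r (\<lambda>p. f p * cnj (g p)))"

definition h2_norm :: "(complex \<times> complex \<Rightarrow> complex) \<Rightarrow> real"
  where "h2_norm f = sqrt (Re (h2_inner f f))"

definition h2_closure ::
    "(complex \<times> complex \<Rightarrow> complex) set \<Rightarrow> (complex \<times> complex \<Rightarrow> complex) set"
  where "h2_closure A = {f \<in> hardy2. \<forall>e>0. \<exists>g\<in>A. h2_norm (\<lambda>p. f p - g p) < e}"

definition M_space :: "(complex \<Rightarrow> complex) \<Rightarrow> (complex \<times> complex \<Rightarrow> complex) set"
  where "M_space \<phi> = h2_closure ((\<lambda>h (z, w). (z - \<phi> w) * h (z, w)) ` hardy_inf)"

definition N_space :: "(complex \<Rightarrow> complex) \<Rightarrow> (complex \<times> complex \<Rightarrow> complex) set"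
  where "N_space \<phi> = {f \<in> hardy2. \<forall>g\<in>M_space \<phi>. h2_inner f g = 0}"

definition orth_proj ::
    "(complex \<times> complex \<Rightarrow> complex) set \<Rightarrow> (complex \<times> complex \<Rightarrow> complex) \<Rightarrow>
      complex \<times> complex \<Rightarrow> complex"
  where "orth_proj V f = (THE g. g \<in> V \<and> (\<forall>h\<in>V. h2_inner (\<lambda>p. f p - g p) h = 0))"

definition S_z ::
    "(complex \<Rightarrow> complex) \<Rightarrow> (complex \<times> complex \<Rightarrow> complex) \<Rightarrow> complex \<times> complex \<Rightarrow> complex"
  where "S_z \<phi> f = orth_proj (N_space \<phi>) (\<lambda>(z, w). z * f (z, w))"

definition bounded_op ::
    "(complex \<times> complex \<Rightarrow> complex) set \<Rightarrow>
      ((complex \<times> complex \<Rightarrow> complex) \<Rightarrow> complex \<times> complex \<Rightarrow> complex) \<Rightarrow> bool"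
  where "bounded_op V T \<longleftrightarrow>
    (\<forall>f\<in>V. T f \<in> V) \<and>
    (\<forall>f\<in>V. \<forall>g\<in>V. T (\<lambda>p. f p + g p) = (\<lambda>p. T f p + T g p)) \<and>
    (\<forall>c. \<forall>f\<in>V. T (\<lambda>p. c * f p) = (\<lambda>p. c * T f p)) \<and>
    (\<exists>C. \<forall>f\<in>V. h2_norm (T f) \<le> C * h2_norm f)"

definition op_spectrum ::
    "(complex \<times> complex \<Rightarrow> complex) set \<Rightarrow>
      ((complex \<times> complex \<Rightarrow> complex) \<Rightarrow> complex \<times> complex \<Rightarrow> complex) \<Rightarrow> complex set"
  where "op_spectrum V T = {l. \<not> (\<exists>R. bounded_op V R \<and>
    (\<forall>f\<in>V. R (\<lambda>p. T f p - l * f p) = f \<and> (\<lambda>p. T (R f) p - l * R f p) = f))}"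

end

theory Submission
  imports Defs
begin

text \<open>
  Expanding in double power series identifies \<open>hardy2\<close> with square-summable coefficient families, so
  it is a Hilbert space with reproducing kernels, \<open>M_space \<phi>\<close> is a closed subspace, and orthogonal
  projections exist.

  If \<open>\<mu> = \<phi> b\<close> lies in the disc, the elements of \<open>M_space \<phi>\<close> vanish at \<open>(\<mu>, b)\<close>. Hence the kernel \<open>k\<close>
  at that point lies in \<open>N_space \<phi>\<close>, and a bounded right inverse \<open>R\<close> of \<open>S_z - l\<close> satisfies
  \<open>(\<mu> - l) (R k) (\<mu>, b) = k (\<mu>, b) = \<parallel>k\<parallel>\<^sup>2\<close>, so \<open>1 \<le> \<bar>\<mu> - l\<bar> \<parallel>R\<parallel>\<close>; letting \<open>\<mu>\<close> tend to \<open>l\<close> excludes such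
  an \<open>R\<close>. Conversely, if a bounded holomorphic \<open>\<psi>\<close> inverts \<open>z - l\<close> modulo \<open>M_space \<phi>\<close>, then the compression
  of multiplication by \<open>\<psi>\<close> is a resolvent: take \<open>\<psi> = 1 / (z - l)\<close> for \<open>\<bar>l\<bar> > 1\<close>, and
  \<open>\<psi> = 1 / (\<phi>(w) - l)\<close> for \<open>l\<close> outside the closed range of \<open>\<phi>\<close>, since
  \<open>(z - l) \<psi> - 1 = (z - \<phi>(w)) \<psi>\<close>.
\<close>

subsection \<open>Integration of monomials over tori\<close>

text \<open>Two obstacles shape the development. \<open>h2_inner\<close> is defined by
  \<open>Lim\<close>, whose value is unspecified unless the limit exists. So nothing can be computed
  with it before an Abel-type argument on coefficients gives existence and the value of the limit;
  the inner product laws and completeness are then carried over from square-summable families, and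
  no boundary functions appear. The second obstacle is that \<open>\<phi>\<close> has bounded
  quadratic means but may be unbounded, so that z - \<open>\<phi>\<close>(w) need not multiply
  \<open>hardy2\<close> into itself, and \<open>M_space \<phi>\<close> is generated by bounded
  multiples only. The symbol 1 / (\<open>\<phi>\<close>(w) - l) copes with this because (z -
  \<open>\<phi>\<close>(w)) / (\<open>\<phi>\<close>(w) - l) = (z - l) / (\<open>\<phi>\<close>(w) -
  l) - 1 is bounded on the bidisc; approximating an arbitrary f by bounded functions then keeps the
  product in \<open>M_space \<phi>\<close>. For the lower inclusion the error z g -
  \<open>S_z\<close> g lies in \<open>M_space \<phi>\<close> and so vanishes at the point of
  evaluation, where z takes the value \<open>\<phi> b\<close>. This turns an operator identity into
  a scalar one.\<close>

definition deg :: "nat \<times> nat \<Rightarrow> nat"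
  where "deg k = fst k + snd k"

definition monomial :: "nat \<times> nat \<Rightarrow> complex \<times> complex \<Rightarrow> complex"
  where "monomial k p = fst p ^ fst k * snd p ^ snd k"

definition torus_pt :: "real \<Rightarrow> real \<times> real \<Rightarrow> complex \<times> complex"
  where "torus_pt r x = (of_real r * cis (fst x), of_real r * cis (snd x))"

abbreviation period_box :: "(real \<times> real) set"
  where "period_box \<equiv> cbox (0, 0) (2 * pi, 2 * pi)"

lemma torus_mean_alt:
  "torus_mean r u = integral period_box (\<lambda>x. u (torus_pt r x)) /\<^sub>R (2 * pi)\<^sup>2"
  by (simp add: torus_mean_def torus_pt_def case_prod_unfold)

lemma norm_torus_pt:
  assumes "0 \<le> r"
  shows "cmod (fst (torus_pt r x)) = r" "cmod (snd (torus_pt r x)) = r"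
  using assms by (simp_all add: torus_pt_def norm_mult)

lemma torus_pt_in_bidisc:
  assumes "0 \<le> r" "r < 1"
  shows "torus_pt r x \<in> bidisc"
  using norm_torus_pt[OF assms(1), of x] assms by (simp add: mem_Times_iff)

lemma torus_mean_cong:
  assumes "0 \<le> r" "\<And>p. cmod (fst p) = r \<Longrightarrow> cmod (snd p) = r \<Longrightarrow> u p = v p"
  shows "torus_mean r u = torus_mean r v"
  unfolding torus_mean_alt using assms(2) norm_torus_pt[OF assms(1)] by simp

lemma continuous_on_torus_pt [continuous_intros]: "continuous_on S (torus_pt r)"
  unfolding torus_pt_def by (intro continuous_intros)

lemma continuous_on_monomial [continuous_intros]:
  "continuous_on S g \<Longrightarrow> continuous_on S (\<lambda>x. monomial k (g x))"
  unfolding monomial_def by (intro continuous_intros)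

lemma norm_monomial_le:
  assumes "cmod (fst p) \<le> r" "cmod (snd p) \<le> r"
  shows "cmod (monomial k p) \<le> r ^ deg k"
proof -
  have "0 \<le> r" using assms norm_ge_zero order_trans by blast
  then show ?thesis
    using assms by (auto simp: monomial_def norm_mult norm_power deg_def power_add
        intro!: mult_mono power_mono)
qed

lemma norm_monomial:
  assumes "cmod (fst p) = r" "cmod (snd p) = r"
  shows "cmod (monomial k p) = r ^ deg k"
  using assms by (simp add: monomial_def norm_mult norm_power deg_def power_add)

lemma summable_geometric2:
  fixes r :: real
  assumes "0 \<le> r" "r < 1"
  shows "(\<lambda>k. r ^ deg k) summable_on UNIV"
proof -
  have s: "(\<lambda>n::nat. r ^ n) summable_on UNIV"
    using assms summable_on_UNIV_nonneg_real_iff[of "\<lambda>n. r ^ n"] by simp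
  have "(\<lambda>x. norm (r ^ fst x * r ^ snd x)) summable_on (UNIV \<times> UNIV)"
  proof (rule Infinite_Sum.abs_summable_on_Sigma_iff[THEN iffD2], intro conjI ballI)
    fix x :: nat
    show "(\<lambda>y. norm (r ^ fst (x, y) * r ^ snd (x, y))) summable_on UNIV"
      using s assms by (simp add: abs_mult power_abs summable_on_cmult_right)
  next
    have "(\<lambda>x. norm (\<Sum>\<^sub>\<infinity>y. norm (r ^ x * r ^ y))) = (\<lambda>x. r ^ x * (\<Sum>\<^sub>\<infinity>y. r ^ y))"
      using assms by (auto simp: abs_mult infsum_cmult_right' infsum_nonneg)
    then show "(\<lambda>x. norm (\<Sum>\<^sub>\<infinity>y. norm (r ^ fst (x, y) * r ^ snd (x, y)))) summable_on UNIV"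
      using s by (simp add: summable_on_cmult_left)
  qed
  then have "(\<lambda>x. r ^ fst x * r ^ snd x) summable_on (UNIV \<times> UNIV)"
    by (rule abs_summable_summable)
  then show ?thesis by (simp add: deg_def power_add)
qed

text \<open>Orthogonality of characters: for n \<noteq> 0 the antiderivative cis(n t) / (i n) takes
  the same value at both ends of the period.\<close>

lemma has_integral_cis_multiple:
  "((\<lambda>t. cis (of_int n * t)) has_integral of_real (if n = 0 then 2 * pi else 0)) {0..2 * pi}"
proof (cases "n = 0")
  case True
  then show ?thesis
    using has_integral_const_real[of "1::complex" 0 "2*pi"] by (simp add: scaleR_conv_of_real)
next
  case False
  have "((\<lambda>t. cis (of_int n * t)) has_integral
      cis (of_int n * (2*pi)) / (\<i> * of_int n) - cis (of_int n * 0) / (\<i> * of_int n)) {0..2 * pi}"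
  proof (rule fundamental_theorem_of_calculus)
    fix t :: real
    show "((\<lambda>t. cis (of_int n * t) / (\<i> * of_int n)) has_vector_derivative cis (of_int n * t))
        (at t within {0..2 * pi})"
      unfolding has_vector_derivative_def
      by (rule has_derivative_eq_rhs, (rule derivative_intros | simp add: False)+)
         (use False in \<open>auto simp: fun_eq_iff scaleR_conv_of_real field_simps\<close>)
  qed simp
  moreover have "cis (of_int n * (2*pi)) = 1"
    using cis_multiple_2pi[of "of_int n"] by (simp add: mult.commute)
  ultimately show ?thesis using False by simp
qed

text \<open>Fubini splits the mean into two character integrals whose frequencies are the
  differences of the exponents. Both circles have radius r, so the squared norm of a monomial
  depends on its total degree alone.\<close>

lemma torus_mean_monomials:
  assumes "0 \<le> r"
  shows "torus_mean r (\<lambda>p. monomial k p * cnj (monomial l p)) =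
    (if k = l then of_real (r ^ (2 * deg k)) else 0)"
proof -
  define d1 where "d1 = int (fst k) - int (fst l)"
  define d2 where "d2 = int (snd k) - int (snd l)"
  have cis_eq: "cis t ^ m * cnj (cis t ^ n) = cis (of_int (int m - int n) * t)" for t m n
    unfolding complex_cnj_power cis_cnj Complex.DeMoivre cis_mult
    by (simp add: algebra_simps)
  have int_cis: "integral {0..2*pi} (\<lambda>t. c * cis (of_int d * t)) = c * of_real (if d = 0 then 2*pi else 0)"
    for c :: complex and d :: int
    by (intro integral_unique has_integral_mult_right has_integral_cis_multiple)
  have "integral period_box (\<lambda>x. monomial k (torus_pt r x) * cnj (monomial l (torus_pt r x)))
      = integral {0..2*pi} (\<lambda>s. integral {0..2*pi} (\<lambda>t.
          monomial k (torus_pt r (s,t)) * cnj (monomial l (torus_pt r (s,t)))))"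
    by (subst integral_prod_continuous) (auto intro!: continuous_intros)
  also have "\<dots> = integral {0..2*pi} (\<lambda>s. integral {0..2*pi} (\<lambda>t.
      (of_real r ^ (deg k + deg l) * cis (of_int d1 * s)) * cis (of_int d2 * t)))"
    unfolding d1_def d2_def cis_eq[symmetric]
    by (simp add: monomial_def torus_pt_def deg_def power_mult_distrib power_add algebra_simps)
  also have "\<dots> = integral {0..2*pi} (\<lambda>s. (of_real r ^ (deg k + deg l) *
      of_real (if d2 = 0 then 2*pi else 0)) * cis (of_int d1 * s))"
    by (rule integral_cong) (unfold int_cis, simp only: ac_simps)
  also have "\<dots> = of_real r ^ (deg k + deg l) * of_real (if d2 = 0 then 2*pi else 0) *
      of_real (if d1 = 0 then 2*pi else 0)"
    by (rule int_cis)
  finally have eq: "torus_mean r (\<lambda>p. monomial k p * cnj (monomial l p)) =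
      (of_real r ^ (deg k + deg l) * of_real (if d2 = 0 then 2*pi else 0) *
      of_real (if d1 = 0 then 2*pi else 0)) /\<^sub>R (2 * pi)\<^sup>2"
    unfolding torus_mean_alt by (rule arg_cong)
  show ?thesis
  proof (cases "k = l")
    case True
    then have d: "d1 = 0" "d2 = 0" "deg k + deg l = 2 * deg k" by (auto simp: d1_def d2_def)
    then show ?thesis
      unfolding eq d by (simp add: True scaleR_conv_of_real power2_eq_square divide_simps)
  next
    case False
    then have "d1 \<noteq> 0 \<or> d2 \<noteq> 0" by (auto simp: d1_def d2_def prod_eq_iff)
    then show ?thesis unfolding eq using False by auto
  qed
qed

text \<open>The exchange of mean and infinite sum behind coefficient extraction, the expansion
  theorem and Parseval. The summable majorant gives uniform convergence along finite index sets, and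
  uniform limits commute with the integral over the compact period box.\<close>

lemma torus_mean_has_sum:
  fixes u :: "'k \<Rightarrow> complex \<times> complex \<Rightarrow> complex"
  assumes "0 \<le> r"
    and cont: "\<And>k. continuous_on period_box (\<lambda>x. u k (torus_pt r x))"
    and le: "\<And>k p. cmod (fst p) = r \<Longrightarrow> cmod (snd p) = r \<Longrightarrow> cmod (u k p) \<le> M k"
    and M: "M summable_on UNIV"
  shows "((\<lambda>k. torus_mean r (u k)) has_sum torus_mean r (\<lambda>p. \<Sum>\<^sub>\<infinity>k. u k p)) UNIV"
proof -
  have "uniform_limit period_box (\<lambda>X x. \<Sum>k\<in>X. u k (torus_pt r x))
      (\<lambda>x. \<Sum>\<^sub>\<infinity>k. u k (torus_pt r x)) (finite_subsets_at_top UNIV)"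
    by (rule Weierstrass_m_test_general[OF _ M]) (use le norm_torus_pt[OF assms(1)] in blast)
  then obtain I J where
    I: "\<And>X. ((\<lambda>x. \<Sum>k\<in>X. u k (torus_pt r x)) has_integral I X) period_box" and
    J: "((\<lambda>x. \<Sum>\<^sub>\<infinity>k. u k (torus_pt r x)) has_integral J) period_box" and
    lim: "(I \<longlongrightarrow> J) (finite_subsets_at_top UNIV)"
    by (rule uniform_limit_integral_cbox) (auto intro!: continuous_intros cont)
  have "I X = (\<Sum>k\<in>X. integral period_box (\<lambda>x. u k (torus_pt r x)))" for X
  proof (cases "finite X")
    case True
    then show ?thesis using integral_unique[OF I[of X]]
      by (simp add: integral_sum integrable_continuous cont)
  next
    \<comment> \<open>The limit along \<open>finite_subsets_at_top\<close> concerns finite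
      \<open>X\<close> only, but an equation for all \<open>X\<close> lets \<open>I\<close> be
      rewritten as a function. For infinite \<open>X\<close> both sides are 0 by the convention for
      \<open>sum\<close>.\<close>
    case False
    then show ?thesis using I[of X] has_integral_unique[of "\<lambda>x. 0" _ period_box 0] by auto
  qed
  then have "((\<lambda>k. integral period_box (\<lambda>x. u k (torus_pt r x))) has_sum J) UNIV"
    using lim unfolding has_sum_def by presburger
  then have "((\<lambda>k. integral period_box (\<lambda>x. u k (torus_pt r x)) /\<^sub>R (2 * pi)\<^sup>2) has_sum
      J /\<^sub>R (2 * pi)\<^sup>2) UNIV"
    by (intro has_sum_scaleR)
  then show ?thesis
    unfolding torus_mean_alt using integral_unique[OF J] by simp
qed

lemma torus_mean_cmult: "torus_mean r (\<lambda>p. c * u p) = c * torus_mean r u" for c :: complex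
  by (simp add: torus_mean_alt)

lemma torus_mean_cnj: "torus_mean r (\<lambda>p. cnj (u p)) = cnj (torus_mean r u)"
  by (simp add: torus_mean_alt integral_cnj)

text \<open>Orthogonality singles out the term with index l; the remaining factor is the squared
  norm of that monomial on the torus of radius r.\<close>

lemma torus_mean_coeff:
  assumes "0 \<le> r" and a: "(\<lambda>k. cmod (a k) * r ^ deg k) summable_on UNIV"
  shows "torus_mean r (\<lambda>p. (\<Sum>\<^sub>\<infinity>k. a k * monomial k p) * cnj (monomial l p)) =
    a l * of_real (r ^ (2 * deg l))"
proof -
  have "((\<lambda>k. torus_mean r (\<lambda>p. (a k * monomial k p) * cnj (monomial l p))) has_sum
      torus_mean r (\<lambda>p. \<Sum>\<^sub>\<infinity>k. (a k * monomial k p) * cnj (monomial l p))) UNIV"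
  proof (rule torus_mean_has_sum[OF assms(1)])
    show "(\<lambda>k. (cmod (a k) * r ^ deg k) * r ^ deg l) summable_on UNIV"
      using a by (rule summable_on_cmult_left)
  qed (auto intro!: continuous_intros simp: norm_mult norm_monomial)
  also have "(\<lambda>k. torus_mean r (\<lambda>p. (a k * monomial k p) * cnj (monomial l p))) =
      (\<lambda>k. a k * (if k = l then of_real (r ^ (2 * deg k)) else 0))"
    using torus_mean_cmult[of r "a _" "\<lambda>p. monomial _ p * cnj (monomial l p)"]
      torus_mean_monomials[OF assms(1), of _ l] by (simp add: mult.assoc)
  finally have *: "((\<lambda>k. a k * (if k = l then of_real (r ^ (2 * deg k)) else 0)) has_sum
      torus_mean r (\<lambda>p. \<Sum>\<^sub>\<infinity>k. (a k * monomial k p) * cnj (monomial l p))) UNIV" .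
  have "((\<lambda>k. a k * (if k = l then of_real (r ^ (2 * deg k)) else 0)) has_sum
      a l * of_real (r ^ (2 * deg l))) UNIV"
    by (rule has_sum_finite_neutralI[of "{l}"]) auto
  from has_sum_unique[OF * this] show ?thesis by (simp add: infsum_cmult_left')
qed

subsection \<open>Double power series and the Cauchy formula\<close>

text \<open>The value 0 off the bidisc follows the convention of \<open>hardy2\<close>, so that an
  expansion becomes an equation between HOL functions.\<close>

definition pser :: "(nat \<times> nat \<Rightarrow> complex) \<Rightarrow> complex \<times> complex \<Rightarrow> complex"
  where "pser a p = (if p \<in> bidisc then \<Sum>\<^sub>\<infinity>k. a k * monomial k p else 0)"

text \<open>Absolute convergence is tested with equal radii in both variables; this suffices because
  the bidisc is exhausted by polydiscs with equal radii.\<close>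

definition conv_bidisc :: "(nat \<times> nat \<Rightarrow> complex) \<Rightarrow> bool"
  where "conv_bidisc a \<longleftrightarrow> (\<forall>r\<ge>0. r < 1 \<longrightarrow> (\<lambda>k. cmod (a k) * r ^ deg k) summable_on UNIV)"

lemma conv_bidiscD:
  "conv_bidisc a \<Longrightarrow> 0 \<le> r \<Longrightarrow> r < 1 \<Longrightarrow> (\<lambda>k. cmod (a k) * r ^ deg k) summable_on UNIV"
  by (simp add: conv_bidisc_def)

lemma conv_bidisc_bounded:
  assumes "\<And>k. cmod (a k) \<le> C"
  shows "conv_bidisc a"
  unfolding conv_bidisc_def
proof (intro allI impI)
  fix r :: real assume r: "0 \<le> r" "r < 1"
  show "(\<lambda>k. cmod (a k) * r ^ deg k) summable_on UNIV"
    by (rule summable_on_comparison_test[OF summable_on_cmult_right[OF summable_geometric2[OF r], of C]])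
       (use assms r in \<open>auto intro!: mult_right_mono\<close>)
qed

lemma bidisc_radius:
  assumes "p \<in> bidisc"
  obtains r where "0 < r" "r < 1" "cmod (fst p) < r" "cmod (snd p) < r"
proof -
  have "max 0 (max (cmod (fst p)) (cmod (snd p))) < 1" using assms by (auto simp: mem_Times_iff)
  from dense[OF this] show ?thesis using that by auto
qed

lemma pser_abs_summable:
  assumes "conv_bidisc a" "p \<in> bidisc"
  shows "(\<lambda>k. norm (a k * monomial k p)) summable_on UNIV"
proof -
  obtain r where r: "0 < r" "r < 1" "cmod (fst p) < r" "cmod (snd p) < r"
    using bidisc_radius[OF assms(2)] .
  show ?thesis
    by (rule summable_on_comparison_test[OF conv_bidiscD[OF assms(1), of r]])
       (use r in \<open>auto simp: norm_mult intro!: mult_left_mono norm_monomial_le\<close>)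
qed

lemma pser_summable:
  assumes "conv_bidisc a" "p \<in> bidisc"
  shows "(\<lambda>k. a k * monomial k p) summable_on UNIV"
  using pser_abs_summable[OF assms] by (rule abs_summable_summable)

section \<open>Termwise differentiation of double power series\<close>

lemma has_derivative_monomial:
  "(monomial k has_derivative (\<lambda>(h, l).
     (of_nat (fst k) * fst p ^ (fst k - 1) * snd p ^ snd k) * h +
     (of_nat (snd k) * fst p ^ fst k * snd p ^ (snd k - 1)) * l)) (at p within S)"
  unfolding monomial_def
  by (rule has_derivative_eq_rhs, (rule derivative_intros)+) (auto simp: fun_eq_iff algebra_simps)

text \<open>Supplies the majorant for the differentiated series. With r < R < 1 the sequence n (r /
  R)^n is bounded, so n r^(n-1) is at most a constant times R^n, and the series converges absolutely
  at radius R.\<close>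

lemma summable_deg_geometric:
  assumes "conv_bidisc a" "0 < r" "r < 1"
  shows "(\<lambda>k. cmod (a k) * (of_nat (deg k) * r ^ (deg k - 1))) summable_on UNIV"
proof -
  obtain R where R: "r < R" "R < 1" using dense[OF \<open>r < 1\<close>] by blast
  have "(\<lambda>n. of_nat n * (r / R) ^ n :: real) \<longlonglongrightarrow> 0"
    using R assms powser_times_n_limit_0[of "r / R"] by simp
  then have "Bseq (\<lambda>n. of_nat n * (r / R) ^ n :: real)"
    using convergent_imp_Bseq convergentI by blast
  then obtain C where C: "\<And>n. norm (of_nat n * (r / R) ^ n :: real) \<le> C" by (auto simp: Bseq_def)
  have le: "of_nat n * r ^ (n - 1) \<le> C / r * R ^ n" for n
  proof -
    have "of_nat n * r ^ (n - 1) = (of_nat n * (r / R) ^ n) * (R ^ n / r)"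
      using assms R by (cases n) (auto simp: power_divide)
    also have "\<dots> \<le> C * (R ^ n / r)"
      using C[of n] assms R by (intro mult_right_mono) auto
    finally show ?thesis by simp
  qed
  show ?thesis
  proof (rule summable_on_comparison_test)
    show "(\<lambda>k. (C / r) * (cmod (a k) * R ^ deg k)) summable_on UNIV"
      using R assms by (intro summable_on_cmult_right conv_bidiscD) auto
    show "cmod (a k) * (of_nat (deg k) * r ^ (deg k - 1)) \<le> (C / r) * (cmod (a k) * R ^ deg k)" for k
      using mult_left_mono[OF le[of "deg k"], of "cmod (a k)"] by (simp add: mult_ac)
  qed (use assms in auto)
qed

text \<open>The operator-norm estimate required for differentiating a series of functions: each of
  the two partial derivatives contributes an error of e / 2.\<close>

lemma sum_partial_derivatives_le:
  fixes A B :: complex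
  assumes "cmod A \<le> e / 2" "cmod B \<le> e / 2"
  shows "norm (A * h + B * l) \<le> e * norm (h, l)"
proof -
  have "norm (A * h + B * l) \<le> cmod A * norm h + cmod B * norm l"
    by (metis norm_mult norm_triangle_ineq)
  also have "\<dots> \<le> e / 2 * norm (h, l) + e / 2 * norm (h, l)"
    using assms norm_fst_le[of h l] norm_snd_le[of l h] order_trans[OF norm_ge_zero assms(1)]
    by (intro add_mono mult_mono) auto
  finally show ?thesis by simp
qed

text \<open>Both series of partial derivatives converge uniformly on a convex polydisc around p
  whose radius is below 1, by the M-test. The double index is enumerated by
  \<open>prod_decode\<close>, since the differentiation theorem concerns series over the
  naturals.\<close>

lemma holomorphic2_pser:
  assumes a: "conv_bidisc a"
  shows "holomorphic2_on (pser a) bidisc"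
  unfolding holomorphic2_on_def
proof
  fix p assume "p \<in> bidisc"
  then obtain r where r: "0 < r" "r < 1" "cmod (fst p) < r" "cmod (snd p) < r"
    using bidisc_radius by blast
  define S where "S = ball (0::complex) r \<times> ball (0::complex) r"
  have S: "open S" "convex S" "p \<in> S" "S \<subseteq> bidisc"
    using r by (auto simp: S_def open_Times convex_Times mem_Times_iff)
  define D1 where "D1 n p = a (prod_decode n) *
    (of_nat (fst (prod_decode n)) * fst p ^ (fst (prod_decode n) - 1) * snd p ^ snd (prod_decode n))" for n p
  define D2 where "D2 n p = a (prod_decode n) *
    (of_nat (snd (prod_decode n)) * fst p ^ fst (prod_decode n) * snd p ^ (snd (prod_decode n) - 1))" for n p
  define M where "M n = cmod (a (prod_decode n)) *
    (of_nat (deg (prod_decode n)) * r ^ (deg (prod_decode n) - 1))" for n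
  have M: "summable M"
    using summable_deg_geometric[OF a r(1,2)]
    by (intro summable_on_imp_summable)
       (simp add: M_def[abs_def] summable_on_reindex_bij_betw[OF bij_prod_decode, symmetric])
  \<comment> \<open>One estimate serves both partial derivatives, with the roles of the variables
    exchanged for the second. At i = 0 the truncated exponent \<open>i - 1\<close> is masked by the
    factor \<open>of_nat i\<close>.\<close>
  have pow: "of_nat i * (x ^ (i - 1) * y ^ j) \<le> of_nat (i + j) * r ^ (i + j - 1)"
    if "0 \<le> x" "x \<le> r" "0 \<le> y" "y \<le> r" for i j :: nat and x y :: real
  proof (cases "i = 0")
    case False
    then have "x ^ (i - 1) * y ^ j \<le> r ^ (i + j - 1)"
      using mult_mono[OF power_mono[OF that(2,1), of "i-1"] power_mono[OF that(4,3), of j]] r(1) that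
      by (simp flip: power_add)
    then show ?thesis using that by (intro mult_mono) auto
  qed (use r in auto)
  have D1: "norm (D1 n q) \<le> M n" if "q \<in> S" for n q
    using that pow[of "cmod (fst q)" "cmod (snd q)" "fst (prod_decode n)" "snd (prod_decode n)"]
    by (auto simp: D1_def M_def deg_def norm_mult norm_power S_def mult.assoc intro!: mult_left_mono)
  have D2: "norm (D2 n q) \<le> M n" if "q \<in> S" for n q
  proof -
    have "norm (D2 n q) = cmod (a (prod_decode n)) * (of_nat (snd (prod_decode n)) *
        (cmod (snd q) ^ (snd (prod_decode n) - 1) * cmod (fst q) ^ fst (prod_decode n)))"
      by (simp add: D2_def norm_mult norm_power)
    also have "\<dots> \<le> M n"
      unfolding M_def deg_def add.commute[of "fst _"]
      by (intro mult_left_mono pow) (use that in \<open>auto simp: S_def\<close>)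
    finally show ?thesis .
  qed
  define g where "g q = (\<lambda>(h, l). suminf (\<lambda>n. D1 n q) * h + suminf (\<lambda>n. D2 n q) * l)" for q
  have sums: "(\<lambda>n. a (prod_decode n) * monomial (prod_decode n) q) sums pser a q" if "q \<in> bidisc" for q
  proof -
    have "((\<lambda>k. a k * monomial k q) has_sum pser a q) UNIV"
      using pser_summable[OF a that] that by (simp add: pser_def)
    then have "((\<lambda>n. a (prod_decode n) * monomial (prod_decode n) q) has_sum pser a q) UNIV"
      by (simp add: has_sum_reindex_bij_betw[OF bij_prod_decode, where f = "\<lambda>k. a k * monomial k q"])
    then show ?thesis by (rule has_sum_imp_sums)
  qed
  have "\<exists>F. \<forall>q\<in>S. (\<lambda>n. a (prod_decode n) * monomial (prod_decode n) q) sums F q \<and>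
      (F has_derivative g q) (at q within S)"
  proof (rule has_derivative_series[OF S(2) _ _ S(3)])
    show "((\<lambda>q. a (prod_decode n) * monomial (prod_decode n) q) has_derivative
        (\<lambda>(h, l). D1 n q * h + D2 n q * l)) (at q within S)" for n q
      by (rule has_derivative_eq_rhs[OF has_derivative_mult_right[OF has_derivative_monomial]])
         (auto simp: fun_eq_iff D1_def D2_def algebra_simps)
  next
    fix e :: real assume "e > 0"
    then have "e / 2 > 0" by simp
    have u1: "\<forall>\<^sub>F n in sequentially. \<forall>q\<in>S. dist (\<Sum>i<n. D1 i q) (\<Sum>i. D1 i q) < e / 2"
      by (rule uniform_limitD[OF Weierstrass_m_test[of S D1 M, OF D1 M] \<open>e / 2 > 0\<close>])
    have u2: "\<forall>\<^sub>F n in sequentially. \<forall>q\<in>S. dist (\<Sum>i<n. D2 i q) (\<Sum>i. D2 i q) < e / 2"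
      by (rule uniform_limitD[OF Weierstrass_m_test[of S D2 M, OF D2 M] \<open>e / 2 > 0\<close>])
    show "\<forall>\<^sub>F n in sequentially. \<forall>q\<in>S. \<forall>h.
        norm ((\<Sum>i<n. (\<lambda>(h, l). D1 i q * h + D2 i q * l) h) - g q h) \<le> e * norm h"
      using u1 u2
    proof eventually_elim
      case (elim n)
      show ?case
      proof (intro ballI allI)
        fix q h assume q: "q \<in> S"
        have eq: "(\<Sum>i<n. (\<lambda>(h, l). D1 i q * h + D2 i q * l) h) - g q h =
          ((\<Sum>i<n. D1 i q) - (\<Sum>i. D1 i q)) * fst h + ((\<Sum>i<n. D2 i q) - (\<Sum>i. D2 i q)) * snd h"
          by (simp add: case_prod_unfold g_def sum.distrib algebra_simps flip: sum_distrib_left)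
        show "norm ((\<Sum>i<n. (\<lambda>(h, l). D1 i q * h + D2 i q * l) h) - g q h) \<le> e * norm h"
          unfolding eq using sum_partial_derivatives_le[of _ e _ "fst h" "snd h"] elim q
          by (simp add: dist_norm less_imp_le)
      qed
    qed
  next
    show "(\<lambda>n. a (prod_decode n) * monomial (prod_decode n) p) sums pser a p"
      by (rule sums[OF \<open>p \<in> bidisc\<close>])
  qed
  then obtain F where F: "\<And>q. q \<in> S \<Longrightarrow> (\<lambda>n. a (prod_decode n) * monomial (prod_decode n) q) sums F q"
    "\<And>q. q \<in> S \<Longrightarrow> (F has_derivative g q) (at q within S)" by blast
  have "F q = pser a q" if "q \<in> S" for q
    using F(1)[OF that] sums[of q] sums_unique2 that S by blast
  then have "(pser a has_derivative g p) (at p within S)"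
    using F(2)[OF S(3)] has_derivative_transform[OF S(3)] by metis
  then have "(pser a has_derivative g p) (at p within bidisc)"
    using S at_within_open[OF S(3,1)] has_derivative_at_withinI by metis
  then show "\<exists>b c. (pser a has_derivative (\<lambda>(h, k). b * h + c * k)) (at p within bidisc)"
    unfolding g_def by blast
qed

lemma holomorphic2_continuous_on: "holomorphic2_on f S \<Longrightarrow> continuous_on S f"
  unfolding holomorphic2_on_def continuous_on_eq_continuous_within
  by (meson has_derivative_continuous)

section \<open>One-variable slices and the Cauchy formula on the torus\<close>

lemma holomorphic2_slices:
  assumes "holomorphic2_on f (A \<times> B)"
  shows "w \<in> B \<Longrightarrow> (\<lambda>z. f (z, w)) holomorphic_on A"
    and "z \<in> A \<Longrightarrow> (\<lambda>w. f (z, w)) holomorphic_on B"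
proof -
  have A: "\<exists>d. ((\<lambda>z. f (z, w)) has_field_derivative d) (at z within A)" if "z \<in> A" "w \<in> B" for z w
  proof -
    from assms that obtain a b where
      d: "(f has_derivative (\<lambda>(h, k). a * h + b * k)) (at (z, w) within A \<times> B)"
      unfolding holomorphic2_on_def by blast
    have "(f has_derivative (\<lambda>(h, k). a * h + b * k)) (at (z, w) within (\<lambda>z. (z, w)) ` A)"
      by (rule has_derivative_subset[OF d]) (use that in auto)
    then have "((\<lambda>z. f (z, w)) has_derivative (\<lambda>h. (\<lambda>(h, k). a * h + b * k) (h, 0))) (at z within A)"
      by (rule has_derivative_in_compose[rotated]) (intro derivative_intros)
    then show ?thesis by (auto simp: has_field_derivative_def)
  qed
  have B: "\<exists>d. ((\<lambda>w. f (z, w)) has_field_derivative d) (at w within B)" if "z \<in> A" "w \<in> B" for z w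
  proof -
    from assms that obtain a b where
      d: "(f has_derivative (\<lambda>(h, k). a * h + b * k)) (at (z, w) within A \<times> B)"
      unfolding holomorphic2_on_def by blast
    have "(f has_derivative (\<lambda>(h, k). a * h + b * k)) (at (z, w) within (\<lambda>w. (z, w)) ` B)"
      by (rule has_derivative_subset[OF d]) (use that in auto)
    then have "((\<lambda>w. f (z, w)) has_derivative (\<lambda>h. (\<lambda>(h, k). a * h + b * k) (0, h))) (at w within B)"
      by (rule has_derivative_in_compose[rotated]) (intro derivative_intros)
    then show ?thesis by (auto simp: has_field_derivative_def)
  qed
  show "w \<in> B \<Longrightarrow> (\<lambda>z. f (z, w)) holomorphic_on A"
    using A by (auto simp: holomorphic_on_def field_differentiable_def)
  show "z \<in> A \<Longrightarrow> (\<lambda>w. f (z, w)) holomorphic_on B"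
    using B by (auto simp: holomorphic_on_def field_differentiable_def)
qed

text \<open>Cauchy's formula with u = r cis t and du = i u dt, which is why the kernel against dt is
  u / (u - z).\<close>

lemma Cauchy_circle_integral:
  fixes g :: "complex \<Rightarrow> complex"
  assumes g: "g holomorphic_on disc" and r: "0 < r" "r < 1" "cmod z < r"
  shows "integral {0..2*pi} (\<lambda>t. g (of_real r * cis t) *
    (of_real r * cis t / (of_real r * cis t - z))) = 2 * pi * g z"
proof -
  have "((\<lambda>u. g u / (u - z)) has_contour_integral (2 * of_real pi * \<i> * g z)) (circlepath 0 r)"
    by (rule Cauchy_integral_circlepath_simple) (use r g in \<open>auto intro: holomorphic_on_subset\<close>)
  then have "((\<lambda>t. g (0 + r * cis t) / (0 + r * cis t - z) * r * \<i> * cis t) has_integral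
      2 * of_real pi * \<i> * g z) {0..2*pi}"
    unfolding circlepath_def by (subst (asm) has_contour_integral_part_circlepath_iff) auto
  then have "((\<lambda>t. - \<i> * (g (0 + r * cis t) / (0 + r * cis t - z) * r * \<i> * cis t)) has_integral
      - \<i> * (2 * of_real pi * \<i> * g z)) {0..2*pi}"
    by (rule has_integral_mult_right)
  also have "(\<lambda>t. - \<i> * (g (0 + r * cis t) / (0 + r * cis t - z) * r * \<i> * cis t)) =
      (\<lambda>t. g (r * cis t) * (r * cis t / (r * cis t - z)))"
    by (intro ext) (simp add: algebra_simps)
  also have "- \<i> * (2 * of_real pi * \<i> * g z) = 2 * pi * g z" by simp
  finally show ?thesis by (rule integral_unique)
qed

text \<open>The kernel is the product of two geometric series with ratios
  \<open>fst p / fst q\<close> and \<open>snd p / snd q\<close>. Domination by a two-parameter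
  geometric series permits iterated summation.\<close>

lemma has_sum_Cauchy_kernel:
  assumes r: "0 < r" and p: "cmod (fst p) < r" "cmod (snd p) < r"
    and q: "cmod (fst q) = r" "cmod (snd q) = r"
  shows "((\<lambda>k. monomial k p / monomial k q) has_sum
    (fst q / (fst q - fst p)) * (snd q / (snd q - snd p))) UNIV"
proof -
  have 1: "((\<lambda>i. (z / u) ^ i) has_sum (u / (u - z))) UNIV" if "cmod z < r" "cmod u = r" for z u
  proof -
    have "u \<noteq> 0" "u - z \<noteq> 0" using that r by auto
    have lt: "cmod (z / u) < 1" using that r by (simp add: norm_divide)
    have "((\<lambda>i. (z / u) ^ i) has_sum (1 / (1 - z / u))) UNIV"
      by (rule norm_summable_imp_has_sum)
         (use lt in \<open>simp_all add: norm_power summable_geometric geometric_sums del: norm_divide\<close>)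
    also have "1 / (1 - z / u) = u / (u - z)"
      using \<open>u \<noteq> 0\<close> \<open>u - z \<noteq> 0\<close> by (simp add: field_simps)
    finally show ?thesis .
  qed
  define z w where "z = fst p / fst q" and "w = snd p / snd q"
  have zw: "cmod z < 1" "cmod w < 1" using p q r by (auto simp: z_def w_def norm_divide)
  define m where "m = max (cmod z) (cmod w)"
  have m: "0 \<le> m" "m < 1" "cmod z \<le> m" "cmod w \<le> m"
    using zw by (auto simp: m_def le_max_iff_disj)
  have "(\<lambda>k. norm (z ^ fst k * w ^ snd k)) summable_on UNIV"
    by (rule summable_on_comparison_test[OF summable_geometric2[OF m(1,2)]])
       (use m norm_monomial_le[of "(z, w)" m] in \<open>auto simp: monomial_def\<close>)
  then have s: "(\<lambda>(i, j). z ^ i * w ^ j) summable_on UNIV \<times> UNIV"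
    by (simp add: case_prod_unfold abs_summable_summable)
  have "((\<lambda>(i, j). z ^ i * w ^ j) has_sum
     (fst q / (fst q - fst p)) * (snd q / (snd q - snd p))) (UNIV \<times> UNIV)"
  proof (rule has_sum_SigmaI[where g = "\<lambda>i. z ^ i * (snd q / (snd q - snd p))"])
    show "((\<lambda>j. case (i, j) of (i, j) \<Rightarrow> z ^ i * w ^ j) has_sum z ^ i * (snd q / (snd q - snd p))) UNIV" for i
      unfolding prod.case w_def by (intro has_sum_cmult_right 1 p q)
    show "((\<lambda>i. z ^ i * (snd q / (snd q - snd p))) has_sum
        fst q / (fst q - fst p) * (snd q / (snd q - snd p))) UNIV"
      unfolding z_def by (intro has_sum_cmult_left 1 p q)
  qed (rule s)
  then show ?thesis
    by (simp add: z_def w_def case_prod_unfold monomial_def power_divide)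
qed

text \<open>The one-variable formula applied twice: the inner integral in the second variable, on a
  slice with the first variable on the circle, and then the outer integral in the first
  variable.\<close>

lemma torus_mean_Cauchy:
  assumes f: "holomorphic2_on f bidisc" and r: "0 < r" "r < 1"
    and p: "cmod (fst p) < r" "cmod (snd p) < r"
  shows "torus_mean r (\<lambda>q. f q * ((fst q / (fst q - fst p)) * (snd q / (snd q - snd p)))) = f p"
proof -
  obtain z w where zw: "p = (z, w)" by force
  have cf: "continuous_on period_box (\<lambda>x. f (torus_pt r x))"
    by (rule continuous_on_compose2[OF holomorphic2_continuous_on[OF f]])
       (use r torus_pt_in_bidisc[of r] in \<open>blast intro: continuous_on_torus_pt less_imp_le\<close>)+
  have nz: "z \<noteq> of_real r * cis s" "w \<noteq> of_real r * cis s" for s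
  proof -
    have "cmod (of_real r * cis s) = r" using r by (simp add: norm_mult)
    then show "z \<noteq> of_real r * cis s" "w \<noteq> of_real r * cis s" using p zw by auto
  qed
  let ?K = "\<lambda>z s. of_real r * cis s / (of_real r * cis s - z)"
  have "integral period_box (\<lambda>x. f (torus_pt r x) * (?K z (fst x) * ?K w (snd x))) =
    integral {0..2*pi} (\<lambda>s. integral {0..2*pi} (\<lambda>t. f (torus_pt r (s, t)) * (?K z s * ?K w t)))"
    by (subst integral_prod_continuous) (auto intro!: continuous_intros cf simp: nz)
  also have "\<dots> = integral {0..2*pi} (\<lambda>s. integral {0..2*pi} (\<lambda>t.
      ?K z s * (f (of_real r * cis s, of_real r * cis t) * ?K w t)))"
    by (simp only: torus_pt_def fst_conv snd_conv mult_ac)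
  also have "\<dots> = integral {0..2*pi} (\<lambda>s. ?K z s * (2 * pi * f (of_real r * cis s, w)))"
  proof (rule integral_cong)
    fix s
    have "of_real r * cis s \<in> disc" using r by (simp add: norm_mult)
    then show "integral {0..2*pi} (\<lambda>t. ?K z s * (f (of_real r * cis s, of_real r * cis t) * ?K w t)) =
      ?K z s * (2 * pi * f (of_real r * cis s, w))"
      using Cauchy_circle_integral[OF holomorphic2_slices(2)[OF f], of "of_real r * cis s" r w] r p zw
      by (simp del: times_divide_eq_right times_divide_eq_left times_divide_times_eq)
  qed
  also have "\<dots> = (2 * pi) * integral {0..2*pi} (\<lambda>s. f (of_real r * cis s, w) * ?K z s)"
    by (simp only: mult_ac flip: integral_mult_right)
  also have "integral {0..2*pi} (\<lambda>s. f (of_real r * cis s, w) * ?K z s) = 2 * pi * f (z, w)"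
    by (rule Cauchy_circle_integral[OF holomorphic2_slices(1)[OF f]]) (use r p zw in auto)
  finally show ?thesis
    by (simp add: torus_mean_alt torus_pt_def zw power2_eq_square scaleR_conv_of_real field_simps)
qed

subsection \<open>Coefficients of Hardy space functions\<close>

lemma continuous_on_bidisc_torus_pt:
  assumes "continuous_on bidisc f" "0 \<le> r" "r < 1"
  shows "continuous_on S (\<lambda>x. f (torus_pt r x))"
  by (rule continuous_on_compose2[OF assms(1)])
     (use torus_pt_in_bidisc[OF assms(2,3)] in \<open>blast intro: continuous_on_torus_pt\<close>)+

lemma bounded_on_torus:
  fixes f :: "complex \<times> complex \<Rightarrow> complex"
  assumes "continuous_on bidisc f" "r < 1"
  obtains B where "\<And>p. cmod (fst p) = r \<Longrightarrow> cmod (snd p) = r \<Longrightarrow> cmod (f p) \<le> B"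
proof -
  have "compact (f ` (sphere 0 r \<times> sphere 0 r))"
    using assms by (intro compact_continuous_image compact_Times continuous_on_subset[OF assms(1)]) auto
  then obtain B where "\<And>x. x \<in> f ` (sphere 0 r \<times> sphere 0 r) \<Longrightarrow> cmod x \<le> B"
    using compact_imp_bounded by (meson bounded_iff)
  then show ?thesis by (intro that[of B]) (force simp: mem_Times_iff)
qed

text \<open>Expanding the Cauchy kernel on the torus of radius R gives a series valid inside that
  radius, with coefficients \<open>c R k\<close>. These do not depend on R, so one family represents
  f on the whole bidisc.\<close>

lemma holomorphic2_has_expansion:
  assumes f: "holomorphic2_on f bidisc"
  obtains a where "conv_bidisc a" "\<And>p. p \<in> bidisc \<Longrightarrow> f p = pser a p"
proof -
  note cf = holomorphic2_continuous_on[OF f]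
  define c where "c R k = torus_mean R (\<lambda>q. f q / monomial k q)" for R k
  have nz: "monomial k q \<noteq> 0" if "0 < R" "cmod (fst q) = R" "cmod (snd q) = R" for k q R
    using norm_monomial[OF that(2,3), of k] that(1) by force
  have expand: "((\<lambda>k. c R k * monomial k p) has_sum f p) UNIV"
    if R: "0 < R" "R < 1" and p: "cmod (fst p) < R" "cmod (snd p) < R" for R p
  proof -
    define m where "m = max (cmod (fst p)) (cmod (snd p))"
    have m: "0 \<le> m" "m < R" "cmod (fst p) \<le> m" "cmod (snd p) \<le> m"
      using p by (auto simp: m_def le_max_iff_disj)
    obtain B where B: "\<And>q. cmod (fst q) = R \<Longrightarrow> cmod (snd q) = R \<Longrightarrow> cmod (f q) \<le> B"
      using bounded_on_torus[OF cf R(2)] by blast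
    have "((\<lambda>k. torus_mean R (\<lambda>q. f q * (monomial k p / monomial k q))) has_sum
        torus_mean R (\<lambda>q. \<Sum>\<^sub>\<infinity>k. f q * (monomial k p / monomial k q))) UNIV"
    proof (rule torus_mean_has_sum)
      show "continuous_on period_box (\<lambda>x. f (torus_pt R x) * (monomial k p / monomial k (torus_pt R x)))" for k
        using R nz[OF R(1) norm_torus_pt]
        by (intro continuous_intros continuous_on_bidisc_torus_pt cf) auto
      show "cmod (f q * (monomial k p / monomial k q)) \<le> B * (m / R) ^ deg k"
        if "cmod (fst q) = R" "cmod (snd q) = R" for k q
        using B[OF that] norm_monomial[OF that, of k] norm_monomial_le[OF m(3,4), of k] R m
          order_trans[OF norm_ge_zero B[OF that]]
        by (simp only: norm_mult norm_divide power_divide) (intro mult_mono divide_right_mono; simp)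
      show "(\<lambda>k. B * (m / R) ^ deg k) summable_on UNIV"
        using m R by (intro summable_on_cmult_right summable_geometric2) auto
    qed (use R in auto)
    moreover have "torus_mean R (\<lambda>q. f q * (monomial k p / monomial k q)) = c R k * monomial k p" for k
      using torus_mean_cmult[of R "monomial k p" "\<lambda>q. f q / monomial k q"]
      by (simp add: c_def mult_ac)
    moreover have "torus_mean R (\<lambda>q. \<Sum>\<^sub>\<infinity>k. f q * (monomial k p / monomial k q)) =
      torus_mean R (\<lambda>q. f q * ((fst q / (fst q - fst p)) * (snd q / (snd q - snd p))))"
    proof (rule torus_mean_cong)
      fix q assume q: "cmod (fst q) = R" "cmod (snd q) = R"
      show "(\<Sum>\<^sub>\<infinity>k. f q * (monomial k p / monomial k q)) =
        f q * ((fst q / (fst q - fst p)) * (snd q / (snd q - snd p)))"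
        by (intro infsumI has_sum_cmult_right has_sum_Cauchy_kernel[OF R(1) p q])
    qed (use R in auto)
    ultimately show ?thesis by (simp only: torus_mean_Cauchy[OF f R p])
  qed
  \<comment> \<open>Evaluating the expansion at the diagonal point (r, r) suffices: unordered
    summability of complex families is absolute, and every monomial there has modulus r^deg.\<close>
  have summ: "(\<lambda>k. cmod (c R k) * r ^ deg k) summable_on UNIV" if "0 \<le> r" "r < R" "R < 1" for r R
  proof -
    have "(\<lambda>k. c R k * monomial k (of_real r, of_real r)) summable_on UNIV"
      using expand[of R "(of_real r, of_real r)"] that by (auto simp: summable_on_def)
    then show ?thesis
      using that norm_monomial[of "(of_real r, of_real r)" r]
      by (simp add: summable_on_iff_abs_summable_on_complex norm_mult)
  qed
  \<comment> \<open>On the smaller torus 1 / \<open>monomial k\<close> is its conjugate divided by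
    \<open>r ^ (2 * deg k)\<close>. Inserting the expansion at radius R therefore makes the mean
    defining \<open>c r k\<close> a coefficient extraction.\<close>
  have uniq: "c r k = c R k" if "0 < r" "r < R" "R < 1" for r R k
  proof -
    have "c r k = torus_mean r (\<lambda>q. (1 / of_real (r ^ (2 * deg k))) *
        ((\<Sum>\<^sub>\<infinity>l. c R l * monomial l q) * cnj (monomial k q)))"
      unfolding c_def[of r]
    proof (rule torus_mean_cong)
      fix q assume q: "cmod (fst q) = r" "cmod (snd q) = r"
      have "f q = (\<Sum>\<^sub>\<infinity>l. c R l * monomial l q)"
        using expand[of R q] q that by (simp add: infsumI)
      moreover have "1 / monomial k q = cnj (monomial k q) / of_real (r ^ (2 * deg k))"
        unfolding complex_div_cnj[of 1] norm_monomial[OF q] power_even_eq by (simp only: mult_1)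
      ultimately show "f q / monomial k q = 1 / of_real (r ^ (2 * deg k)) *
        ((\<Sum>\<^sub>\<infinity>l. c R l * monomial l q) * cnj (monomial k q))"
        by (simp only: divide_inverse mult_1_left mult_ac)
    qed (use that in auto)
    also have "\<dots> = c R k"
      using that torus_mean_coeff[of r "c R" k] summ[of r R] unfolding torus_mean_cmult by simp
    finally show ?thesis .
  qed
  \<comment> \<open>The radius 1/2 is an arbitrary reference; the radii R below are chosen above
    \<open>max r (1/2)\<close> so that they can be compared with it.\<close>
  define a where "a = c (1/2)"
  have a_eq: "a = c R" if "1/2 < R" "R < 1" for R
    unfolding a_def using uniq[of "1/2" R] that by auto
  show ?thesis
  proof (rule that)
    show "conv_bidisc a"
      unfolding conv_bidisc_def
    proof (intro allI impI)
      fix r :: real assume "0 \<le> r" "r < 1"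
      moreover from \<open>r < 1\<close> obtain R where "max r (1/2) < R" "R < 1" using dense[of "max r (1/2)" 1] by auto
      ultimately show "(\<lambda>k. cmod (a k) * r ^ deg k) summable_on UNIV"
        using summ[of r R] a_eq[of R] by simp
    qed
  next
    fix p assume p: "p \<in> bidisc"
    obtain r where r: "0 < r" "r < 1" "cmod (fst p) < r" "cmod (snd p) < r"
      using bidisc_radius[OF p] .
    then obtain R where R: "max r (1/2) < R" "R < 1" using dense[of "max r (1/2)" 1] by auto
    then have "((\<lambda>k. a k * monomial k p) has_sum f p) UNIV"
      using expand[of R p] r a_eq[of R] by simp
    then show "f p = pser a p" using p by (simp add: pser_def infsumI)
  qed
qed

lemma continuous_on_pser: "conv_bidisc a \<Longrightarrow> continuous_on bidisc (pser a)"
  by (intro holomorphic2_continuous_on holomorphic2_pser)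

text \<open>Parseval on the torus of radius r. Only the first factor is expanded; the second is kept
  as a bounded function, and each resulting mean is the conjugate of a coefficient extraction from
  b.\<close>

lemma torus_mean_pser:
  assumes a: "conv_bidisc a" and b: "conv_bidisc b" and r: "0 \<le> r" "r < 1"
  shows "((\<lambda>k. a k * cnj (b k) * of_real (r ^ (2 * deg k))) has_sum
    torus_mean r (\<lambda>p. pser a p * cnj (pser b p))) UNIV"
proof -
  have pser_torus: "pser c p = (\<Sum>\<^sub>\<infinity>k. c k * monomial k p)"
    if "cmod (fst p) = r" "cmod (snd p) = r" for c p
    using that r by (simp add: pser_def mem_Times_iff)
  obtain B where B: "\<And>p. cmod (fst p) = r \<Longrightarrow> cmod (snd p) = r \<Longrightarrow> cmod (pser b p) \<le> B"
    using bounded_on_torus[OF continuous_on_pser[OF b] r(2)] by blast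
  have "((\<lambda>k. torus_mean r (\<lambda>p. a k * monomial k p * cnj (pser b p))) has_sum
      torus_mean r (\<lambda>p. \<Sum>\<^sub>\<infinity>k. a k * monomial k p * cnj (pser b p))) UNIV"
  proof (rule torus_mean_has_sum[OF r(1)])
    show "continuous_on period_box (\<lambda>x. a k * monomial k (torus_pt r x) * cnj (pser b (torus_pt r x)))" for k
      by (intro continuous_intros continuous_on_bidisc_torus_pt continuous_on_pser b r)
    show "cmod (a k * monomial k p * cnj (pser b p)) \<le> cmod (a k) * r ^ deg k * B"
      if "cmod (fst p) = r" "cmod (snd p) = r" for k p
      using B[OF that] norm_monomial[OF that, of k] r by (simp add: norm_mult mult_left_mono)
    show "(\<lambda>k. cmod (a k) * r ^ deg k * B) summable_on UNIV"
      by (intro summable_on_cmult_left conv_bidiscD a r)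
  qed
  moreover have "torus_mean r (\<lambda>p. a k * monomial k p * cnj (pser b p)) =
      a k * cnj (b k) * of_real (r ^ (2 * deg k))" for k
  proof -
    have "torus_mean r (\<lambda>p. a k * monomial k p * cnj (pser b p)) =
        torus_mean r (\<lambda>p. a k * cnj (pser b p * cnj (monomial k p)))"
      by (simp add: mult_ac)
    also have "\<dots> = a k * cnj (torus_mean r (\<lambda>p. pser b p * cnj (monomial k p)))"
      by (simp only: torus_mean_cmult torus_mean_cnj)
    also have "torus_mean r (\<lambda>p. pser b p * cnj (monomial k p)) =
        torus_mean r (\<lambda>p. (\<Sum>\<^sub>\<infinity>l. b l * monomial l p) * cnj (monomial k p))"
      by (rule torus_mean_cong[OF r(1)]) (simp only: pser_torus)
    also have "\<dots> = b k * of_real (r ^ (2 * deg k))"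
      by (rule torus_mean_coeff[OF r(1) conv_bidiscD[OF b r]])
    finally show ?thesis by simp
  qed
  moreover have "torus_mean r (\<lambda>p. \<Sum>\<^sub>\<infinity>k. a k * monomial k p * cnj (pser b p)) =
      torus_mean r (\<lambda>p. pser a p * cnj (pser b p))"
    by (rule torus_mean_cong[OF r(1)]) (simp add: pser_torus infsum_cmult_left')
  ultimately show ?thesis by simp
qed

lemma torus_mean_of_real:
  assumes "(\<lambda>x. u (torus_pt r x)) integrable_on period_box"
  shows "torus_mean r (\<lambda>p. complex_of_real (u p)) = complex_of_real (torus_mean r u)"
  unfolding torus_mean_alt
  using integral_unique[OF has_integral_of_real[OF integrable_integral[OF assms]]]
  by (simp add: scaleR_conv_of_real)

lemma torus_mean_pser_norm:
  assumes a: "conv_bidisc a" and r: "0 \<le> r" "r < 1"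
  shows "((\<lambda>k. (cmod (a k))\<^sup>2 * r ^ (2 * deg k)) has_sum torus_mean r (\<lambda>p. (cmod (pser a p))\<^sup>2)) UNIV"
proof -
  have int: "(\<lambda>x. (cmod (pser a (torus_pt r x)))\<^sup>2) integrable_on period_box"
    by (intro integrable_continuous continuous_intros continuous_on_bidisc_torus_pt continuous_on_pser a r)
  have "((\<lambda>k. complex_of_real ((cmod (a k))\<^sup>2 * r ^ (2 * deg k))) has_sum
      complex_of_real (torus_mean r (\<lambda>p. (cmod (pser a p))\<^sup>2))) UNIV"
    unfolding torus_mean_of_real[OF int, symmetric] of_real_mult complex_norm_square
    by (rule torus_mean_pser[OF a a r])
  then show ?thesis by (simp only: has_sum_of_real_iff)
qed

section \<open>Square-summable coefficient families and the limit at the boundary\<close>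

definition l2 :: "('k \<Rightarrow> complex) \<Rightarrow> bool"
  where "l2 a \<longleftrightarrow> (\<lambda>k. (cmod (a k))\<^sup>2) summable_on UNIV"

lemma l2_abs_summable:
  assumes "l2 a" "l2 b"
  shows "(\<lambda>k. cmod (a k * cnj (b k))) summable_on UNIV"
  using assms abs_summable_product[of a UNIV "\<lambda>k. cnj (b k)"]
  by (simp add: l2_def norm_mult power2_eq_square)

lemma l2_summable:
  assumes "l2 a" "l2 b"
  shows "(\<lambda>k. a k * cnj (b k)) summable_on UNIV"
  using l2_abs_summable[OF assms] by (rule abs_summable_summable)

lemma l2_le_norm:
  assumes "l2 a"
  shows "cmod (a k) \<le> sqrt (\<Sum>\<^sub>\<infinity>k. (cmod (a k))\<^sup>2)"
proof (rule real_le_rsqrt)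
  show "(cmod (a k))\<^sup>2 \<le> (\<Sum>\<^sub>\<infinity>k. (cmod (a k))\<^sup>2)"
    using finite_sum_le_infsum[of "\<lambda>k. (cmod (a k))\<^sup>2" UNIV "{k}"] assms by (simp add: l2_def)
qed

lemma l2_conv_bidisc: "l2 a \<Longrightarrow> conv_bidisc a"
  by (rule conv_bidisc_bounded[OF l2_le_norm])

text \<open>An Abel limit in the absolutely summable case: domination by \<open>cmod (g k)\<close>
  is uniform on [0, 1], so the sum is continuous up to r = 1.\<close>

lemma tendsto_Abel2:
  fixes g :: "nat \<times> nat \<Rightarrow> complex"
  assumes "(\<lambda>k. cmod (g k)) summable_on UNIV"
  shows "((\<lambda>r. \<Sum>\<^sub>\<infinity>k. g k * of_real (r ^ (2 * deg k))) \<longlongrightarrow> (\<Sum>\<^sub>\<infinity>k. g k)) (at_left 1)"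
proof -
  have "continuous_on {0..1} (\<lambda>r. \<Sum>\<^sub>\<infinity>k. g k * of_real (r ^ (2 * deg k)))"
  proof (rule uniform_limit_theorem)
    show "uniform_limit {0..1} (\<lambda>X r. \<Sum>k\<in>X. g k * of_real (r ^ (2 * deg k)))
        (\<lambda>r. \<Sum>\<^sub>\<infinity>k. g k * of_real (r ^ (2 * deg k))) (finite_subsets_at_top UNIV)"
      by (rule Weierstrass_m_test_general[OF _ assms])
         (auto simp: norm_mult norm_power power_le_one intro!: mult_left_le)
    show "\<forall>\<^sub>F X in finite_subsets_at_top UNIV.
        continuous_on {0..1} (\<lambda>r. \<Sum>k\<in>X. g k * of_real (r ^ (2 * deg k)))"
      by (intro always_eventually allI continuous_intros)
  qed auto
  then have "((\<lambda>r. \<Sum>\<^sub>\<infinity>k. g k * of_real (r ^ (2 * deg k))) \<longlongrightarrow> (\<Sum>\<^sub>\<infinity>k. g k)) (at 1 within {0..1})"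
    by (auto simp: continuous_on_def dest!: bspec[of _ _ 1])
  then show ?thesis
    by (simp add: at_within_Icc_at_left)
qed

lemma eventually_at_left_one: "\<forall>\<^sub>F r in at_left (1::real). r \<in> {0<..<1}"
  by (rule eventually_at_leftI[of 0]) auto

lemma torus_mean_pser_tendsto:
  assumes "l2 a" "l2 b"
  shows "((\<lambda>r. torus_mean r (\<lambda>p. pser a p * cnj (pser b p))) \<longlongrightarrow>
    (\<Sum>\<^sub>\<infinity>k. a k * cnj (b k))) (at_left 1)"
proof (rule Lim_transform_eventually[OF tendsto_Abel2[OF l2_abs_summable[OF assms]]])
  show "\<forall>\<^sub>F r in at_left 1. (\<Sum>\<^sub>\<infinity>k. a k * cnj (b k) * of_real (r ^ (2 * deg k))) =
      torus_mean r (\<lambda>p. pser a p * cnj (pser b p))"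
    using eventually_at_left_one
  proof eventually_elim
    case (elim r)
    show ?case
      by (intro infsumI torus_mean_pser l2_conv_bidisc assms) (use elim in auto)
  qed
qed

lemma h2_inner_pser:
  assumes "l2 a" "l2 b"
  shows "h2_inner (pser a) (pser b) = (\<Sum>\<^sub>\<infinity>k. a k * cnj (b k))"
  unfolding h2_inner_def by (rule tendsto_Lim[OF _ torus_mean_pser_tendsto[OF assms]]) simp

text \<open>A Fatou argument: each finite partial sum is continuous in r, so the bound on the means
  passes to r = 1 for finite index sets, and then to their supremum.\<close>

lemma pser_mean_bound:
  assumes a: "conv_bidisc a"
    and B: "\<And>r. 0 < r \<Longrightarrow> r < 1 \<Longrightarrow> torus_mean r (\<lambda>p. (cmod (pser a p))\<^sup>2) \<le> B"
  shows "l2 a" "(\<Sum>\<^sub>\<infinity>k. (cmod (a k))\<^sup>2) \<le> B"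
proof -
  have le: "(\<Sum>k\<in>F. (cmod (a k))\<^sup>2) \<le> B" if "finite F" for F
  proof (rule tendsto_upperbound)
    have "((\<lambda>r::real. \<Sum>k\<in>F. (cmod (a k))\<^sup>2 * r ^ (2 * deg k)) \<longlongrightarrow>
        (\<Sum>k\<in>F. (cmod (a k))\<^sup>2 * 1 ^ (2 * deg k))) (at_left 1)"
      by (intro tendsto_intros)
    then show "((\<lambda>r::real. \<Sum>k\<in>F. (cmod (a k))\<^sup>2 * r ^ (2 * deg k)) \<longlongrightarrow>
        (\<Sum>k\<in>F. (cmod (a k))\<^sup>2)) (at_left 1)" by simp
    show "\<forall>\<^sub>F r in at_left 1. (\<Sum>k\<in>F. (cmod (a k))\<^sup>2 * r ^ (2 * deg k)) \<le> B"
      using eventually_at_left_one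
    proof eventually_elim
      case (elim r)
      have "(\<Sum>k\<in>F. (cmod (a k))\<^sup>2 * r ^ (2 * deg k)) \<le> torus_mean r (\<lambda>p. (cmod (pser a p))\<^sup>2)"
        by (rule finite_sum_le_has_sum[OF torus_mean_pser_norm[OF a]]) (use elim that in auto)
      with B[of r] elim show ?case by auto
    qed
  qed simp
  then show l2: "l2 a"
    unfolding l2_def by (intro nonneg_bdd_above_summable_on bdd_aboveI2[where M = B]) auto
  show "(\<Sum>\<^sub>\<infinity>k. (cmod (a k))\<^sup>2) \<le> B"
    by (rule infsum_le_finite_sums) (use l2 le in \<open>auto simp: l2_def\<close>)
qed

lemma torus_mean_pser_le:
  assumes "l2 a" "0 \<le> r" "r < 1"
  shows "torus_mean r (\<lambda>p. (cmod (pser a p))\<^sup>2) \<le> (\<Sum>\<^sub>\<infinity>k. (cmod (a k))\<^sup>2)"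
proof (rule has_sum_mono[OF torus_mean_pser_norm[OF l2_conv_bidisc] has_sum_infsum])
  show "(cmod (a k))\<^sup>2 * r ^ (2 * deg k) \<le> (cmod (a k))\<^sup>2" for k
    using assms by (intro mult_left_le power_le_one) auto
qed (use assms in \<open>auto simp: l2_def\<close>)

lemma pser_in_hardy2:
  assumes "l2 a"
  shows "pser a \<in> hardy2"
  unfolding hardy2_def
proof (intro CollectI conjI)
  show "holomorphic2_on (pser a) bidisc" by (rule holomorphic2_pser[OF l2_conv_bidisc[OF assms]])
  show "bdd_above ((\<lambda>r. torus_mean r (\<lambda>p. (cmod (pser a p))\<^sup>2)) ` {0<..<1})"
    by (rule bdd_aboveI2, rule torus_mean_pser_le[OF assms]) auto
qed (simp add: pser_def)

lemma hardy2_obtain_coeffs: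
  assumes "f \<in> hardy2"
  obtains a where "l2 a" "f = pser a"
proof -
  have f: "holomorphic2_on f bidisc" "\<And>p. p \<notin> bidisc \<Longrightarrow> f p = 0"
    "bdd_above ((\<lambda>r. torus_mean r (\<lambda>p. (cmod (f p))\<^sup>2)) ` {0<..<1})"
    using assms unfolding hardy2_def mem_Collect_eq by (blast, blast, simp)
  obtain a where a: "conv_bidisc a" "\<And>p. p \<in> bidisc \<Longrightarrow> f p = pser a p"
    using holomorphic2_has_expansion[OF f(1)] by blast
  have fa: "f = pser a"
    using a(2) f(2) by (metis ext pser_def)
  obtain B where "\<And>r. r \<in> {0<..<1} \<Longrightarrow> torus_mean r (\<lambda>p. (cmod (pser a p))\<^sup>2) \<le> B"
    using f(3) unfolding fa bdd_above_def by blast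
  then have "l2 a" by (intro pser_mean_bound(1)[OF a(1)]) auto
  with fa that show ?thesis by blast
qed

subsection \<open>Hilbert space structure\<close>

lemma pser_add:
  assumes "conv_bidisc a" "conv_bidisc b"
  shows "pser (\<lambda>k. a k + b k) = (\<lambda>p. pser a p + pser b p)"
proof
  fix p
  show "pser (\<lambda>k. a k + b k) p = pser a p + pser b p"
  proof (cases "p \<in> bidisc")
    case True
    then show ?thesis
      using infsum_add[OF pser_summable[OF assms(1) True] pser_summable[OF assms(2) True]]
      by (simp add: pser_def distrib_right)
  qed (simp add: pser_def)
qed

lemma pser_cmult: "pser (\<lambda>k. c * a k) = (\<lambda>p. c * pser a p)"
  by (auto simp: pser_def fun_eq_iff mult.assoc infsum_cmult_right')

lemma l2_add:
  assumes "l2 a" "l2 b"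
  shows "l2 (\<lambda>k. a k + b k)"
  unfolding l2_def
proof (rule summable_on_comparison_test)
  show "(\<lambda>k. 2 * (cmod (a k))\<^sup>2 + 2 * (cmod (b k))\<^sup>2) summable_on UNIV"
    using assms by (intro summable_on_add summable_on_cmult_right) (auto simp: l2_def)
  show "(cmod (a k + b k))\<^sup>2 \<le> 2 * (cmod (a k))\<^sup>2 + 2 * (cmod (b k))\<^sup>2" for k
  proof -
    have "(cmod (a k + b k))\<^sup>2 \<le> (cmod (a k) + cmod (b k))\<^sup>2"
      by (intro power_mono norm_triangle_ineq) auto
    also have "\<dots> \<le> 2 * (cmod (a k))\<^sup>2 + 2 * (cmod (b k))\<^sup>2"
      using sum_squares_bound[of "cmod (a k)" "cmod (b k)"] by (simp add: power2_sum)
    finally show ?thesis .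
  qed
qed auto

lemma l2_cmult: "l2 a \<Longrightarrow> l2 (\<lambda>k. c * a k)"
  by (auto simp: l2_def norm_mult power_mult_distrib intro: summable_on_cmult_right)

lemma pser_diff:
  assumes "l2 a" "l2 b"
  shows "pser (\<lambda>k. a k - b k) = (\<lambda>p. pser a p - pser b p)" "l2 (\<lambda>k. a k - b k)"
  using pser_add[OF l2_conv_bidisc[OF assms(1)] l2_conv_bidisc[OF l2_cmult[OF assms(2), of "-1"]]]
    l2_add[OF assms(1) l2_cmult[OF assms(2), of "-1"]]
  unfolding pser_cmult by simp_all

lemma hardy2_add: "f \<in> hardy2 \<Longrightarrow> g \<in> hardy2 \<Longrightarrow> (\<lambda>p. f p + g p) \<in> hardy2"
  by (elim hardy2_obtain_coeffs) (simp add: pser_in_hardy2 l2_add l2_conv_bidisc flip: pser_add)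

lemma hardy2_cmult: "f \<in> hardy2 \<Longrightarrow> (\<lambda>p. c * f p) \<in> hardy2"
  by (elim hardy2_obtain_coeffs) (simp add: pser_in_hardy2 l2_cmult flip: pser_cmult)

lemma hardy2_diff: "f \<in> hardy2 \<Longrightarrow> g \<in> hardy2 \<Longrightarrow> (\<lambda>p. f p - g p) \<in> hardy2"
  using hardy2_add[of f "\<lambda>p. -1 * g p"] hardy2_cmult[of g "-1"] by simp

lemma h2_inner_add_left:
  assumes "f \<in> hardy2" "g \<in> hardy2" "h \<in> hardy2"
  shows "h2_inner (\<lambda>p. f p + g p) h = h2_inner f h + h2_inner g h"
proof -
  obtain a b c where "l2 a" "f = pser a" "l2 b" "g = pser b" "l2 c" "h = pser c"
    using assms hardy2_obtain_coeffs by metis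
  then show ?thesis
    by (simp add: h2_inner_pser l2_add l2_conv_bidisc distrib_right infsum_add l2_summable flip: pser_add)
qed

lemma h2_inner_cmult_left:
  assumes "f \<in> hardy2" "h \<in> hardy2"
  shows "h2_inner (\<lambda>p. c * f p) h = c * h2_inner f h"
proof -
  obtain a b where "l2 a" "f = pser a" "l2 b" "h = pser b"
    using assms hardy2_obtain_coeffs by metis
  then show ?thesis
    by (simp add: h2_inner_pser l2_cmult mult.assoc infsum_cmult_right' flip: pser_cmult)
qed

lemma h2_inner_commute:
  assumes "f \<in> hardy2" "g \<in> hardy2"
  shows "h2_inner g f = cnj (h2_inner f g)"
proof -
  obtain a b where "l2 a" "f = pser a" "l2 b" "g = pser b"
    using assms hardy2_obtain_coeffs by metis
  then show ?thesis
    by (simp add: h2_inner_pser mult.commute flip: infsum_cnj)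
qed

lemma h2_inner_diff_left:
  assumes "f \<in> hardy2" "g \<in> hardy2" "h \<in> hardy2"
  shows "h2_inner (\<lambda>p. f p - g p) h = h2_inner f h - h2_inner g h"
  using h2_inner_add_left[OF assms(1) hardy2_cmult[OF assms(2), of "-1"] assms(3)]
    h2_inner_cmult_left[OF assms(2,3), of "-1"] by simp

lemma h2_inner_self_pser:
  assumes "l2 a"
  shows "h2_inner (pser a) (pser a) = of_real (\<Sum>\<^sub>\<infinity>k. (cmod (a k))\<^sup>2)"
proof -
  have "((\<lambda>k. complex_of_real ((cmod (a k))\<^sup>2)) has_sum of_real (\<Sum>\<^sub>\<infinity>k. (cmod (a k))\<^sup>2)) UNIV"
    by (intro has_sum_of_real has_sum_infsum) (use assms in \<open>simp add: l2_def\<close>)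
  then show ?thesis
    unfolding h2_inner_pser[OF assms assms] complex_norm_square[symmetric] by (rule infsumI)
qed

lemma h2_norm_pser:
  assumes "l2 a"
  shows "(h2_norm (pser a))\<^sup>2 = (\<Sum>\<^sub>\<infinity>k. (cmod (a k))\<^sup>2)"
  unfolding h2_norm_def h2_inner_self_pser[OF assms] by (simp add: infsum_nonneg)

lemma h2_inner_self:
  assumes "f \<in> hardy2"
  shows "h2_inner f f = of_real ((h2_norm f)\<^sup>2)"
  using assms hardy2_obtain_coeffs h2_inner_self_pser h2_norm_pser by metis

lemma h2_norm_nonneg:
  assumes "f \<in> hardy2"
  shows "0 \<le> h2_norm f"
proof -
  obtain a where "l2 a" "f = pser a" using assms hardy2_obtain_coeffs by metis
  then show ?thesis unfolding h2_norm_def by (simp add: h2_inner_self_pser infsum_nonneg)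
qed

text \<open>Coefficient functionals are contractive. This gives definiteness of the norm, and in the
  completeness proof it makes each coordinate a Cauchy sequence.\<close>

lemma l2_coeff_le_h2_norm:
  assumes "l2 a"
  shows "cmod (a k) \<le> h2_norm (pser a)"
  using l2_le_norm[OF assms, of k] h2_norm_pser[OF assms] h2_norm_nonneg[OF pser_in_hardy2[OF assms]]
  by (metis real_sqrt_unique)

lemma h2_norm_eq_0D:
  assumes "f \<in> hardy2" "h2_norm f = 0"
  shows "f = (\<lambda>_. 0)"
proof -
  obtain a where a: "l2 a" "f = pser a" using assms hardy2_obtain_coeffs by metis
  then have "a k = 0" for k using l2_coeff_le_h2_norm[OF a(1), of k] assms by simp
  then show ?thesis using a by (auto simp: pser_def fun_eq_iff)
qed

lemma h2_norm_cmult: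
  assumes "f \<in> hardy2"
  shows "h2_norm (\<lambda>p. c * f p) = cmod c * h2_norm f"
proof (rule power2_eq_imp_eq)
  have "of_real ((h2_norm (\<lambda>p. c * f p))\<^sup>2) = (c * cnj c) * h2_inner f f"
    using h2_inner_self[OF hardy2_cmult[OF assms, of c]]
      h2_inner_cmult_left[OF assms hardy2_cmult[OF assms, of c], of c]
      h2_inner_commute[OF hardy2_cmult[OF assms, of c] assms] h2_inner_cmult_left[OF assms assms, of c]
      h2_inner_self[OF assms]
    by (simp add: mult.assoc)
  also have "\<dots> = of_real ((cmod c * h2_norm f)\<^sup>2)"
    by (simp add: h2_inner_self[OF assms] power_mult_distrib complex_norm_square[of c, symmetric])
  finally show "(h2_norm (\<lambda>p. c * f p))\<^sup>2 = (cmod c * h2_norm f)\<^sup>2"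
    using of_real_eq_iff by blast
qed (use assms in \<open>auto intro!: mult_nonneg_nonneg h2_norm_nonneg hardy2_cmult\<close>)

lemma h2_norm_minus_commute:
  assumes "f \<in> hardy2" "g \<in> hardy2"
  shows "h2_norm (\<lambda>p. f p - g p) = h2_norm (\<lambda>p. g p - f p)"
  using h2_norm_cmult[OF hardy2_diff[OF assms], of "-1"] by simp

lemma h2_norm_add_sq:
  assumes "f \<in> hardy2" "g \<in> hardy2"
  shows "(h2_norm (\<lambda>p. f p + g p))\<^sup>2 = (h2_norm f)\<^sup>2 + 2 * Re (h2_inner f g) + (h2_norm g)\<^sup>2"
proof -
  let ?s = "\<lambda>p. f p + g p"
  have s: "?s \<in> hardy2" by (intro hardy2_add assms)
  have "h2_inner ?s ?s = cnj (h2_inner ?s f) + cnj (h2_inner ?s g)"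
    using h2_inner_add_left[OF assms s] h2_inner_commute[OF s assms(1)] h2_inner_commute[OF s assms(2)]
    by simp
  also have "\<dots> = h2_inner f f + h2_inner f g + cnj (h2_inner f g) + h2_inner g g"
    using h2_inner_add_left[OF assms assms(1)] h2_inner_add_left[OF assms assms(2)]
      h2_inner_commute[OF assms] h2_inner_self[OF assms(1)] h2_inner_self[OF assms(2)] by simp
  finally have "Re (h2_inner ?s ?s) =
      Re (h2_inner f f + h2_inner f g + cnj (h2_inner f g) + h2_inner g g)"
    by (rule arg_cong)
  then show ?thesis
    unfolding h2_inner_self[OF s] h2_inner_self[OF assms(1)] h2_inner_self[OF assms(2)] by simp
qed

text \<open>The quadratic in c on which both the Cauchy-Schwarz inequality and the orthogonality of
  minimisers rest.\<close>

lemma h2_norm_diff_cmult_sq: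
  assumes "f \<in> hardy2" "g \<in> hardy2"
  shows "(h2_norm (\<lambda>p. f p - c * g p))\<^sup>2 =
    (h2_norm f)\<^sup>2 - 2 * Re (cnj c * h2_inner f g) + (cmod c)\<^sup>2 * (h2_norm g)\<^sup>2"
proof -
  have "h2_inner f (\<lambda>p. - c * g p) = - cnj c * h2_inner f g"
    using h2_inner_commute[OF hardy2_cmult[OF assms(2), of "-c"] assms(1)]
      h2_inner_cmult_left[OF assms(2,1), of "-c"] h2_inner_commute[OF assms(2,1)] by simp
  then show ?thesis
    using h2_norm_add_sq[OF assms(1) hardy2_cmult[OF assms(2), of "-c"]] h2_norm_cmult[OF assms(2), of "-c"]
    by (simp add: power_mult_distrib)
qed

lemma h2_Cauchy_Schwarz:
  assumes "f \<in> hardy2" "g \<in> hardy2"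
  shows "cmod (h2_inner f g) \<le> h2_norm f * h2_norm g"
proof (cases "h2_norm g = 0")
  case True
  then have "h2_inner g f = 0"
    using h2_norm_eq_0D[OF assms(2)] h2_inner_cmult_left[OF assms(2,1), of 0] by simp
  then show ?thesis using h2_inner_commute[OF assms(2,1)] True by simp
next
  case False
  define n where "n = (h2_norm g)\<^sup>2"
  have n: "n > 0" using False by (simp add: n_def)
  \<comment> \<open>The minimiser of the quadratic in c, that is, the coefficient of the projection
    of f onto the line spanned by g.\<close>
  let ?c = "h2_inner f g / of_real n"
  have re: "Re (cnj ?c * h2_inner f g) = (cmod (h2_inner f g))\<^sup>2 / n"
    by (simp add: mult.commute[of "cnj _"] flip: complex_norm_square)
  have "0 \<le> (h2_norm f)\<^sup>2 - 2 * ((cmod (h2_inner f g))\<^sup>2 / n) + (cmod ?c)\<^sup>2 * n"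
    using zero_le_power2[of "h2_norm (\<lambda>p. f p - ?c * g p)"]
    by (simp only: h2_norm_diff_cmult_sq[OF assms] re n_def[symmetric])
  also have "(cmod ?c)\<^sup>2 * n = (cmod (h2_inner f g))\<^sup>2 / n"
    using n by (simp add: norm_divide power_divide power2_eq_square)
  finally have "(cmod (h2_inner f g))\<^sup>2 \<le> (h2_norm f)\<^sup>2 * n"
    using n by (simp add: field_simps)
  then have "(cmod (h2_inner f g))\<^sup>2 \<le> (h2_norm f * h2_norm g)\<^sup>2"
    by (simp add: n_def power_mult_distrib)
  then show ?thesis
    by (rule power2_le_imp_le) (use assms in \<open>auto intro!: mult_nonneg_nonneg h2_norm_nonneg\<close>)
qed

lemma h2_norm_triangle:
  assumes "f \<in> hardy2" "g \<in> hardy2"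
  shows "h2_norm (\<lambda>p. f p + g p) \<le> h2_norm f + h2_norm g"
proof (rule power2_le_imp_le)
  show "(h2_norm (\<lambda>p. f p + g p))\<^sup>2 \<le> (h2_norm f + h2_norm g)\<^sup>2"
    using h2_norm_add_sq[OF assms] h2_Cauchy_Schwarz[OF assms] complex_Re_le_cmod[of "h2_inner f g"]
    by (simp add: power2_sum)
qed (use assms in \<open>auto intro!: add_nonneg_nonneg h2_norm_nonneg\<close>)

lemma h2_norm_triangle_diff:
  assumes "f \<in> hardy2" "g \<in> hardy2" "h \<in> hardy2"
  shows "h2_norm (\<lambda>p. f p - h p) \<le> h2_norm (\<lambda>p. f p - g p) + h2_norm (\<lambda>p. g p - h p)"
  using h2_norm_triangle[OF hardy2_diff[OF assms(1,2)] hardy2_diff[OF assms(2,3)]] by simp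

lemma h2_parallelogram:
  assumes "f \<in> hardy2" "g \<in> hardy2"
  shows "(h2_norm (\<lambda>p. f p + g p))\<^sup>2 + (h2_norm (\<lambda>p. f p - g p))\<^sup>2 =
    2 * (h2_norm f)\<^sup>2 + 2 * (h2_norm g)\<^sup>2"
  using h2_norm_add_sq[OF assms] h2_norm_diff_cmult_sq[OF assms, of 1] by simp

text \<open>Coordinatewise limits of the coefficient families provide the candidate; the Cauchy
  estimate is passed to the limit on finite index sets. Strict inequality is lost there, hence \<le>
  in the conclusion.\<close>

lemma hardy2_complete:
  fixes F :: "nat \<Rightarrow> complex \<times> complex \<Rightarrow> complex"
  assumes F: "\<And>n. F n \<in> hardy2"
    and Cauchy: "\<And>e. e > 0 \<Longrightarrow> \<exists>N. \<forall>m\<ge>N. \<forall>n\<ge>N. h2_norm (\<lambda>p. F m p - F n p) < e"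
  obtains f where "f \<in> hardy2" "\<And>e. e > 0 \<Longrightarrow> \<exists>N. \<forall>n\<ge>N. h2_norm (\<lambda>p. F n p - f p) \<le> e"
proof -
  have "\<forall>n. \<exists>a. l2 a \<and> F n = pser a" using F hardy2_obtain_coeffs by metis
  then obtain A where A: "\<And>n. l2 (A n)" "\<And>n. F n = pser (A n)" by metis
  have diff: "(\<lambda>p. F m p - F n p) = pser (\<lambda>k. A m k - A n k)" "l2 (\<lambda>k. A m k - A n k)" for m n
    using pser_diff[OF A(1)[of m] A(1)[of n]] A(2) by simp_all
  have "convergent (\<lambda>n. A n k)" for k
  proof (rule Cauchy_convergent, rule metric_CauchyI)
    fix e :: real assume "e > 0"
    then obtain N where N: "\<forall>m\<ge>N. \<forall>n\<ge>N. h2_norm (\<lambda>p. F m p - F n p) < e" using Cauchy by blast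
    have "dist (A m k) (A n k) < e" if "m \<ge> N" "n \<ge> N" for m n
      using N that l2_coeff_le_h2_norm[OF diff(2)[of m n], of k] unfolding dist_norm diff(1)
      by (meson le_less_trans)
    then show "\<exists>N. \<forall>m\<ge>N. \<forall>n\<ge>N. dist (A m k) (A n k) < e" by blast
  qed
  then have "\<forall>k. \<exists>l. (\<lambda>n. A n k) \<longlonglongrightarrow> l" by (simp add: convergent_def)
  then obtain a where a: "\<And>k. (\<lambda>n. A n k) \<longlonglongrightarrow> a k" by metis
  \<comment> \<open>Square-summability of the difference and its bound come together, both from
    finite sums in which m tends to infinity. Square-summability of \<open>a\<close> follows
    afterwards, as \<open>A N\<close> minus the difference.\<close>
  have tail: "\<exists>N. \<forall>n\<ge>N. l2 (\<lambda>k. A n k - a k) \<and> (\<Sum>\<^sub>\<infinity>k. (cmod (A n k - a k))\<^sup>2) \<le> e\<^sup>2" if e: "e > 0" for e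
  proof -
    obtain N where N: "\<forall>m\<ge>N. \<forall>n\<ge>N. h2_norm (\<lambda>p. F m p - F n p) < e" using Cauchy e by blast
    have fin: "(\<Sum>k\<in>X. (cmod (A n k - a k))\<^sup>2) \<le> e\<^sup>2" if "finite X" "n \<ge> N" for X n
    proof (rule tendsto_upperbound)
      show "(\<lambda>m. \<Sum>k\<in>X. (cmod (A n k - A m k))\<^sup>2) \<longlonglongrightarrow> (\<Sum>k\<in>X. (cmod (A n k - a k))\<^sup>2)"
        by (intro tendsto_intros a)
      show "\<forall>\<^sub>F m in sequentially. (\<Sum>k\<in>X. (cmod (A n k - A m k))\<^sup>2) \<le> e\<^sup>2"
        using eventually_ge_at_top[of N]
      proof eventually_elim
        case (elim m)
        have "(\<Sum>k\<in>X. (cmod (A n k - A m k))\<^sup>2) \<le> (\<Sum>\<^sub>\<infinity>k. (cmod (A n k - A m k))\<^sup>2)"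
          using diff(2)[of n m] that by (intro finite_sum_le_infsum) (auto simp: l2_def)
        also have "\<dots> = (h2_norm (\<lambda>p. F n p - F m p))\<^sup>2"
          using diff[of n m] h2_norm_pser by simp
        also have "\<dots> \<le> e\<^sup>2"
          using N elim that by (intro power_mono h2_norm_nonneg hardy2_diff F) (auto intro: less_imp_le)
        finally show ?case .
      qed
    qed simp
    have "l2 (\<lambda>k. A n k - a k)" if "n \<ge> N" for n
      unfolding l2_def using fin[OF _ that]
      by (intro nonneg_bdd_above_summable_on bdd_aboveI2[where M = "e\<^sup>2"]) auto
    moreover have "(\<Sum>\<^sub>\<infinity>k. (cmod (A n k - a k))\<^sup>2) \<le> e\<^sup>2" if "n \<ge> N" for n
      using calculation[OF that] fin[OF _ that] by (intro infsum_le_finite_sums) (auto simp: l2_def)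
    ultimately show ?thesis by blast
  qed
  obtain N where "l2 (\<lambda>k. A N k - a k)" using tail[of 1] by auto
  then have a2: "l2 a" using pser_diff(2)[OF A(1)[of N]] by fastforce
  show ?thesis
  proof (rule that[of "pser a"])
    show "pser a \<in> hardy2" by (rule pser_in_hardy2[OF a2])
    fix e :: real assume e: "e > 0"
    obtain N where N: "\<forall>n\<ge>N. l2 (\<lambda>k. A n k - a k) \<and> (\<Sum>\<^sub>\<infinity>k. (cmod (A n k - a k))\<^sup>2) \<le> e\<^sup>2"
      using tail[OF e] by blast
    have "h2_norm (\<lambda>p. F n p - pser a p) \<le> e" if "n \<ge> N" for n
    proof (rule power2_le_imp_le)
      show "(h2_norm (\<lambda>p. F n p - pser a p))\<^sup>2 \<le> e\<^sup>2"
        using N that pser_diff[OF A(1)[of n] a2] h2_norm_pser A(2) by metis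
    qed (use e in auto)
    then show "\<exists>N. \<forall>n\<ge>N. h2_norm (\<lambda>p. F n p - pser a p) \<le> e" by blast
  qed
qed

subsection \<open>Orthogonal projection, multipliers and reproducing kernels\<close>

definition closed_subspace :: "(complex \<times> complex \<Rightarrow> complex) set \<Rightarrow> bool"
  where "closed_subspace V \<longleftrightarrow> V \<subseteq> hardy2 \<and> V \<noteq> {} \<and>
    (\<forall>f\<in>V. \<forall>g\<in>V. (\<lambda>p. f p + g p) \<in> V) \<and> (\<forall>c. \<forall>f\<in>V. (\<lambda>p. c * f p) \<in> V) \<and>
    (\<forall>f\<in>hardy2. (\<forall>e>0. \<exists>g\<in>V. h2_norm (\<lambda>p. f p - g p) < e) \<longrightarrow> f \<in> V)"

lemma closed_subspaceD:
  assumes "closed_subspace V"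
  shows "f \<in> V \<Longrightarrow> f \<in> hardy2" "V \<noteq> {}"
    "f \<in> V \<Longrightarrow> g \<in> V \<Longrightarrow> (\<lambda>p. f p + g p) \<in> V" "f \<in> V \<Longrightarrow> (\<lambda>p. c * f p) \<in> V"
    "f \<in> hardy2 \<Longrightarrow> (\<And>e. e > 0 \<Longrightarrow> \<exists>g\<in>V. h2_norm (\<lambda>p. f p - g p) < e) \<Longrightarrow> f \<in> V"
  using assms unfolding closed_subspace_def by blast+

text \<open>Moving f by a small multiple of g lowers the squared norm to first order by 2 t times
  the squared modulus of the inner product, while the second-order cost is quadratic in t.\<close>

lemma h2_inner_eq_0_if_minimal:
  assumes f: "f \<in> hardy2" and g: "g \<in> hardy2"
    and min: "\<And>c. h2_norm f \<le> h2_norm (\<lambda>p. f p - c * g p)"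
  shows "h2_inner f g = 0"
proof (rule ccontr)
  assume nz: "h2_inner f g \<noteq> 0"
  define q where "q = (cmod (h2_inner f g))\<^sup>2"
  define n where "n = (h2_norm g)\<^sup>2"
  have q: "q > 0" using nz by (simp add: q_def)
  have n: "n \<ge> 0" by (simp add: n_def)
  \<comment> \<open>Small enough that \<open>t * n < 1\<close>, which makes the first-order gain
    win; the summand 1 covers n = 0.\<close>
  define t where "t = 1 / (n + 1)"
  have t: "t > 0" "t * n < 1" using n by (auto simp: t_def field_simps)
  let ?c = "of_real t * h2_inner f g"
  have "(h2_norm f)\<^sup>2 \<le> (h2_norm (\<lambda>p. f p - ?c * g p))\<^sup>2"
    by (intro power_mono min h2_norm_nonneg f)
  also have "\<dots> = (h2_norm f)\<^sup>2 - 2 * Re (cnj ?c * h2_inner f g) + (cmod ?c)\<^sup>2 * n"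
    unfolding n_def by (rule h2_norm_diff_cmult_sq[OF f g])
  also have "Re (cnj ?c * h2_inner f g) = t * q"
    unfolding q_def cmod_power2 by (simp add: power2_eq_square algebra_simps)
  also have "(cmod ?c)\<^sup>2 = t\<^sup>2 * q" by (simp add: q_def norm_mult power_mult_distrib)
  finally have "2 * t * q \<le> t * q * (t * n)" by (simp add: power2_eq_square algebra_simps)
  also have "\<dots> \<le> t * q * 1" using t q by (intro mult_left_mono) auto
  finally show False using t q by simp
qed

lemma projection_exists:
  assumes V: "closed_subspace V" and f: "f \<in> hardy2"
  obtains m where "m \<in> V" "\<And>x. x \<in> V \<Longrightarrow> h2_inner (\<lambda>p. f p - m p) x = 0"
proof -
  note VD = closed_subspaceD[OF V]
  define d where "d = (INF m\<in>V. (h2_norm (\<lambda>p. f p - m p))\<^sup>2)"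
  have d_le: "d \<le> (h2_norm (\<lambda>p. f p - m p))\<^sup>2" if "m \<in> V" for m
    unfolding d_def by (rule cINF_lower[OF _ that]) (auto intro!: bdd_belowI2[where m = 0])
  have "\<exists>m\<in>V. (h2_norm (\<lambda>p. f p - m p))\<^sup>2 < d + inverse (real (Suc n))" for n
  proof -
    have "d < d + inverse (real (Suc n))" by simp
    then show ?thesis
      unfolding d_def using VD(2) by (subst (asm) cINF_less_iff) (auto intro!: bdd_belowI2[where m = 0])
  qed
  then obtain m where m: "\<And>n. m n \<in> V"
    "\<And>n. (h2_norm (\<lambda>p. f p - m n p))\<^sup>2 < d + inverse (real (Suc n))"
    by metis
  have mH: "m n \<in> hardy2" for n using VD(1) m(1) by blast
  \<comment> \<open>The midpoint of \<open>m i\<close> and \<open>m j\<close> stays in V, so its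
    squared distance to f is at least d. In the parallelogram law this cancels the contribution 4 d
    of the two nearly minimal distances.\<close>
  have gap: "(h2_norm (\<lambda>p. m i p - m j p))\<^sup>2 \<le> 2 * inverse (real (Suc i)) + 2 * inverse (real (Suc j))" for i j
  proof -
    let ?a = "\<lambda>p. f p - m i p" and ?b = "\<lambda>p. f p - m j p"
    let ?h = "\<lambda>p. (1/2) * (m i p + m j p)"
    have hV: "?h \<in> V" by (intro VD(3,4) m(1))
    have "(\<lambda>p. ?a p + ?b p) = (\<lambda>p. 2 * (f p - ?h p))" by (auto simp: fun_eq_iff algebra_simps)
    then have "h2_norm (\<lambda>p. ?a p + ?b p) = 2 * h2_norm (\<lambda>p. f p - ?h p)"
      using h2_norm_cmult[OF hardy2_diff[OF f VD(1)[OF hV]], of 2] by simp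
    then have "(h2_norm (\<lambda>p. ?a p + ?b p))\<^sup>2 \<ge> 4 * d"
      using d_le[OF hV] by (simp add: power_mult_distrib)
    moreover have "h2_norm (\<lambda>p. ?a p - ?b p) = h2_norm (\<lambda>p. m i p - m j p)"
      using h2_norm_minus_commute[OF mH[of i] mH[of j]] by (simp add: algebra_simps)
    ultimately show ?thesis
      using h2_parallelogram[OF hardy2_diff[OF f mH[of i]] hardy2_diff[OF f mH[of j]]] m(2)[of i] m(2)[of j]
      by simp
  qed
  have "\<exists>N. \<forall>i\<ge>N. \<forall>j\<ge>N. h2_norm (\<lambda>p. m i p - m j p) < e" if e: "e > 0" for e
  proof -
    obtain N where N: "inverse (real (Suc N)) < e\<^sup>2 / 4"
      using reals_Archimedean[of "e\<^sup>2 / 4"] e by auto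
    have "h2_norm (\<lambda>p. m i p - m j p) < e" if "i \<ge> N" "j \<ge> N" for i j
    proof (rule power2_less_imp_less)
      have "inverse (real (Suc i)) \<le> inverse (real (Suc N))" "inverse (real (Suc j)) \<le> inverse (real (Suc N))"
        using that by (auto intro!: le_imp_inverse_le)
      then show "(h2_norm (\<lambda>p. m i p - m j p))\<^sup>2 < e\<^sup>2" using gap[of i j] N by linarith
    qed (use e in simp)
    then show ?thesis by blast
  qed
  then obtain g where g: "g \<in> hardy2" "\<And>e. e > 0 \<Longrightarrow> \<exists>N. \<forall>n\<ge>N. h2_norm (\<lambda>p. m n p - g p) \<le> e"
    using hardy2_complete[of m] mH by metis
  have gV: "g \<in> V"
  proof (rule VD(5)[OF g(1)])
    fix e :: real assume "e > 0"
    then obtain N where "h2_norm (\<lambda>p. m N p - g p) \<le> e / 2" using g(2)[of "e/2"] by auto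
    then show "\<exists>h\<in>V. h2_norm (\<lambda>p. g p - h p) < e"
      using h2_norm_minus_commute[OF g(1) mH[of N]] m(1)[of N] \<open>e > 0\<close> by force
  qed
  have "h2_norm (\<lambda>p. f p - g p) \<le> sqrt d"
  proof (rule field_le_epsilon)
    fix e :: real assume e: "e > 0"
    obtain N where N: "\<forall>n\<ge>N. h2_norm (\<lambda>p. m n p - g p) \<le> e / 2" using g(2)[of "e/2"] e by auto
    \<comment> \<open>Since d is an infimum of squared distances, the excess is compared with
      \<open>(e / 2)\<^sup>2\<close>, and then \<open>(sqrt d)\<^sup>2 + (e / 2)\<^sup>2 \<le> (sqrt
      d + e / 2)\<^sup>2\<close>.\<close>
    obtain K where K: "inverse (real (Suc K)) < (e / 2)\<^sup>2"
      using reals_Archimedean[of "(e/2)\<^sup>2"] e by auto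
    define n where "n = max N K"
    have d0: "d \<ge> 0" unfolding d_def using VD(2) by (intro cINF_greatest) auto
    have "inverse (real (Suc n)) \<le> inverse (real (Suc K))"
      by (auto intro!: le_imp_inverse_le simp: n_def)
    then have "(h2_norm (\<lambda>p. f p - m n p))\<^sup>2 \<le> (sqrt d)\<^sup>2 + (e / 2)\<^sup>2"
      using m(2)[of n] K unfolding real_sqrt_pow2[OF d0] by linarith
    also have "\<dots> \<le> (sqrt d + e / 2)\<^sup>2" using d0 e by (simp add: power2_sum)
    finally have "h2_norm (\<lambda>p. f p - m n p) \<le> sqrt d + e / 2"
      by (rule power2_le_imp_le) (use d0 e in auto)
    then show "h2_norm (\<lambda>p. f p - g p) \<le> sqrt d + e"
      using h2_norm_triangle_diff[OF f mH[of n] g(1)] N[rule_format, of n] by (auto simp: n_def)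
  qed
  also have "sqrt d \<le> h2_norm (\<lambda>p. f p - x p)" if "x \<in> V" for x
    using d_le[OF that] h2_norm_nonneg[OF hardy2_diff[OF f VD(1)[OF that]]] by (rule real_le_lsqrt[rotated])
  finally have min: "h2_norm (\<lambda>p. f p - g p) \<le> h2_norm (\<lambda>p. f p - x p)" if "x \<in> V" for x
    using that by blast
  show ?thesis
  proof (rule that[OF gV])
    fix x assume x: "x \<in> V"
    show "h2_inner (\<lambda>p. f p - g p) x = 0"
    proof (rule h2_inner_eq_0_if_minimal)
      fix c
      have "(\<lambda>p. g p + c * x p) \<in> V" by (intro VD(3,4) gV x)
      from min[OF this] show "h2_norm (\<lambda>p. f p - g p) \<le> h2_norm (\<lambda>p. f p - g p - c * x p)"
        by (simp add: algebra_simps)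
    qed (use f g x VD in \<open>auto intro: hardy2_diff\<close>)
  qed
qed

section \<open>Multiplication by bounded holomorphic functions and density of bounded
  functions\<close>

lemma holomorphic2_mult:
  assumes "holomorphic2_on f S" "holomorphic2_on g S"
  shows "holomorphic2_on (\<lambda>p. f p * g p) S"
  unfolding holomorphic2_on_def
proof
  fix p assume "p \<in> S"
  then obtain a b c d where
    "(f has_derivative (\<lambda>(h, k). a * h + b * k)) (at p within S)"
    "(g has_derivative (\<lambda>(h, k). c * h + d * k)) (at p within S)"
    using assms unfolding holomorphic2_on_def by blast
  from has_derivative_mult[OF this]
  have "((\<lambda>p. f p * g p) has_derivative (\<lambda>(h, k). (f p * c + a * g p) * h + (f p * d + b * g p) * k)) (at p within S)"
    by (rule has_derivative_eq_rhs) (auto simp: fun_eq_iff algebra_simps)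
  then show "\<exists>a b. ((\<lambda>p. f p * g p) has_derivative (\<lambda>(h, k). a * h + b * k)) (at p within S)" by blast
qed

lemma holomorphic2_diff:
  assumes "holomorphic2_on f S" "holomorphic2_on g S"
  shows "holomorphic2_on (\<lambda>p. f p - g p) S"
  unfolding holomorphic2_on_def
proof
  fix p assume "p \<in> S"
  then obtain a b c d where
    "(f has_derivative (\<lambda>(h, k). a * h + b * k)) (at p within S)"
    "(g has_derivative (\<lambda>(h, k). c * h + d * k)) (at p within S)"
    using assms unfolding holomorphic2_on_def by blast
  from has_derivative_diff[OF this]
  have "((\<lambda>p. f p - g p) has_derivative (\<lambda>(h, k). (a - c) * h + (b - d) * k)) (at p within S)"
    by (rule has_derivative_eq_rhs) (auto simp: fun_eq_iff algebra_simps)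
  then show "\<exists>a b. ((\<lambda>p. f p - g p) has_derivative (\<lambda>(h, k). a * h + b * k)) (at p within S)" by blast
qed

lemma holomorphic2_fst:
  assumes "g holomorphic_on A"
  shows "holomorphic2_on (\<lambda>p. g (fst p)) (A \<times> B)"
  unfolding holomorphic2_on_def
proof
  fix p assume p: "p \<in> A \<times> B"
  then obtain d where "(g has_field_derivative d) (at (fst p) within A)"
    using assms by (auto simp: holomorphic_on_def field_differentiable_def)
  then have "(g has_derivative (*) d) (at (fst p) within fst ` (A \<times> B))"
    unfolding has_field_derivative_def by (rule has_derivative_subset) auto
  from has_derivative_in_compose[OF has_derivative_fst[OF has_derivative_ident] this]
  show "\<exists>a b. ((\<lambda>p. g (fst p)) has_derivative (\<lambda>(h, k). a * h + b * k)) (at p within A \<times> B)"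
    by (intro exI[of _ d] exI[of _ 0]) (simp add: case_prod_unfold)
qed

lemma holomorphic2_snd:
  assumes "g holomorphic_on B"
  shows "holomorphic2_on (\<lambda>p. g (snd p)) (A \<times> B)"
  unfolding holomorphic2_on_def
proof
  fix p assume p: "p \<in> A \<times> B"
  then obtain d where "(g has_field_derivative d) (at (snd p) within B)"
    using assms by (auto simp: holomorphic_on_def field_differentiable_def)
  then have "(g has_derivative (*) d) (at (snd p) within snd ` (A \<times> B))"
    unfolding has_field_derivative_def by (rule has_derivative_subset) auto
  from has_derivative_in_compose[OF has_derivative_snd[OF has_derivative_ident] this]
  show "\<exists>a b. ((\<lambda>p. g (snd p)) has_derivative (\<lambda>(h, k). a * h + b * k)) (at p within A \<times> B)"
    by (intro exI[of _ 0] exI[of _ d]) (simp add: case_prod_unfold)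
qed

lemma torus_mean_mono:
  fixes u v :: "complex \<times> complex \<Rightarrow> real"
  assumes "continuous_on bidisc u" "continuous_on bidisc v" "0 \<le> r" "r < 1"
    and "\<And>p. p \<in> bidisc \<Longrightarrow> u p \<le> v p"
  shows "torus_mean r u \<le> torus_mean r v"
  unfolding torus_mean_alt
proof (rule scaleR_left_mono)
  show "integral period_box (\<lambda>x. u (torus_pt r x)) \<le> integral period_box (\<lambda>x. v (torus_pt r x))"
    using assms torus_pt_in_bidisc[OF assms(3,4)]
    by (intro integral_le integrable_continuous continuous_on_bidisc_torus_pt) blast+
qed simp

lemma hardy2_vanishes: "f \<in> hardy2 \<Longrightarrow> p \<notin> bidisc \<Longrightarrow> f p = 0"
  unfolding hardy2_def by blast

lemma hardy2_holomorphic: "f \<in> hardy2 \<Longrightarrow> holomorphic2_on f bidisc"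
  unfolding hardy2_def by blast

lemma hardy2I:
  assumes "holomorphic2_on f bidisc" "\<And>p. p \<notin> bidisc \<Longrightarrow> f p = 0"
    and "\<And>r. 0 < r \<Longrightarrow> r < 1 \<Longrightarrow> torus_mean r (\<lambda>p. (cmod (f p))\<^sup>2) \<le> B"
  shows "f \<in> hardy2"
  unfolding hardy2_def mem_Collect_eq
  by (intro conjI allI impI assms(1,2) bdd_aboveI2[of _ _ B] assms(3)) auto

text \<open>Together with \<open>h2_norm_le\<close> this makes the squared norm the least upper
  bound of the means, so that norm estimates reduce to pointwise comparison on tori.\<close>

lemma torus_mean_le_h2_norm:
  assumes "f \<in> hardy2" "0 \<le> r" "r < 1"
  shows "torus_mean r (\<lambda>p. (cmod (f p))\<^sup>2) \<le> (h2_norm f)\<^sup>2"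
  using assms hardy2_obtain_coeffs h2_norm_pser torus_mean_pser_le by metis

lemma h2_norm_le:
  assumes "f \<in> hardy2" "\<And>r. 0 < r \<Longrightarrow> r < 1 \<Longrightarrow> torus_mean r (\<lambda>p. (cmod (f p))\<^sup>2) \<le> B"
  shows "(h2_norm f)\<^sup>2 \<le> B"
proof -
  obtain a where a: "l2 a" "f = pser a" using assms(1) hardy2_obtain_coeffs by metis
  show ?thesis
    using pser_mean_bound(2)[OF l2_conv_bidisc[OF a(1)], of B] assms(2) h2_norm_pser[OF a(1)]
    unfolding a(2) by simp
qed

text \<open>The bound holds pointwise on each torus and hence for the means. The product vanishes
  off the bidisc because f does, whatever values \<open>\<psi>\<close> takes there.\<close>

lemma hardy2_mult:
  assumes psi: "holomorphic2_on \<psi> bidisc" "\<And>p. p \<in> bidisc \<Longrightarrow> cmod (\<psi> p) \<le> B"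
    and f: "f \<in> hardy2"
  shows "(\<lambda>p. \<psi> p * f p) \<in> hardy2" "h2_norm (\<lambda>p. \<psi> p * f p) \<le> B * h2_norm f"
proof -
  have "(0, 0) \<in> bidisc" by simp
  then have B: "B \<ge> 0" using psi(2) norm_ge_zero order_trans by blast
  have hol: "holomorphic2_on (\<lambda>p. \<psi> p * f p) bidisc"
    by (intro holomorphic2_mult psi hardy2_holomorphic f)
  have le: "torus_mean r (\<lambda>p. (cmod (\<psi> p * f p))\<^sup>2) \<le> (B * h2_norm f)\<^sup>2" if "0 < r" "r < 1" for r
  proof -
    have "torus_mean r (\<lambda>p. (cmod (\<psi> p * f p))\<^sup>2) \<le> torus_mean r (\<lambda>p. B\<^sup>2 * (cmod (f p))\<^sup>2)"
    proof (rule torus_mean_mono)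
      show "(cmod (\<psi> p * f p))\<^sup>2 \<le> B\<^sup>2 * (cmod (f p))\<^sup>2" if "p \<in> bidisc" for p
        using psi(2)[OF that] by (auto simp: norm_mult power_mult_distrib intro!: mult_right_mono power_mono)
    qed (use that in \<open>auto intro!: continuous_intros holomorphic2_continuous_on hol hardy2_holomorphic f
        simp del: norm_mult\<close>)
    also have "\<dots> = B\<^sup>2 * torus_mean r (\<lambda>p. (cmod (f p))\<^sup>2)"
      by (simp add: torus_mean_alt)
    also have "\<dots> \<le> B\<^sup>2 * (h2_norm f)\<^sup>2"
      using that f by (intro mult_left_mono torus_mean_le_h2_norm) auto
    finally show ?thesis by (simp add: power_mult_distrib)
  qed
  show H: "(\<lambda>p. \<psi> p * f p) \<in> hardy2"
    by (rule hardy2I[OF hol _ le]) (simp_all add: hardy2_vanishes[OF f] del: mem_Times_iff)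
  show "h2_norm (\<lambda>p. \<psi> p * f p) \<le> B * h2_norm f"
    by (rule power2_le_imp_le[OF h2_norm_le[OF H le]]) (use B f in \<open>auto intro!: mult_nonneg_nonneg h2_norm_nonneg\<close>)
qed

text \<open>The approximants are polynomials, cut off outside the bidisc, obtained by keeping
  finitely many coefficients.\<close>

lemma hardy_inf_dense:
  assumes f: "f \<in> hardy2" and e: "e > 0"
  obtains h where "h \<in> hardy_inf" "h \<in> hardy2" "h2_norm (\<lambda>p. f p - h p) < e"
proof -
  obtain a where a: "l2 a" "f = pser a" using f hardy2_obtain_coeffs by metis
  define s where "s = (\<Sum>\<^sub>\<infinity>k. (cmod (a k))\<^sup>2)"
  have hs: "((\<lambda>k. (cmod (a k))\<^sup>2) has_sum s) UNIV"
    using a(1) unfolding l2_def s_def by (rule has_sum_infsum)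
  \<comment> \<open>The approximation comes with \<le>, and the factor 1/2 restores the strict
    inequality of the claim.\<close>
  have "\<exists>F. finite F \<and> F \<subseteq> UNIV \<and> dist (\<Sum>k\<in>F. (cmod (a k))\<^sup>2) s \<le> e\<^sup>2 / 2"
    using has_sum_finite_approximation[OF hs, of "e\<^sup>2 / 2"] e by auto
  then obtain F where F: "finite F" "dist (\<Sum>k\<in>F. (cmod (a k))\<^sup>2) s \<le> e\<^sup>2 / 2" by blast
  define b where "b k = (if k \<in> F then a k else 0)" for k
  have bs: "((\<lambda>k. (cmod (b k))\<^sup>2) has_sum (\<Sum>k\<in>F. (cmod (a k))\<^sup>2)) UNIV"
    by (rule has_sum_finite_neutralI[OF F(1)]) (auto simp: b_def)
  then have b: "l2 b" unfolding l2_def by (auto simp: summable_on_def)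
  have "((\<lambda>k. (cmod (a k))\<^sup>2 + - (cmod (b k))\<^sup>2) has_sum (s + - (\<Sum>k\<in>F. (cmod (a k))\<^sup>2))) UNIV"
    by (intro has_sum_add hs has_sum_uminusI bs)
  \<comment> \<open>Each \<open>b k\<close> is either \<open>a k\<close> or 0, so the squares
    subtract exactly.\<close>
  also have "(\<lambda>k. (cmod (a k))\<^sup>2 + - (cmod (b k))\<^sup>2) = (\<lambda>k. (cmod (a k - b k))\<^sup>2)"
    by (auto simp: b_def fun_eq_iff)
  finally have "(h2_norm (\<lambda>p. f p - pser b p))\<^sup>2 = s - (\<Sum>k\<in>F. (cmod (a k))\<^sup>2)"
    using h2_norm_pser[OF pser_diff(2)[OF a(1) b]] unfolding a(2) pser_diff(1)[OF a(1) b]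
    by (simp add: infsumI)
  also have "\<dots> \<le> e\<^sup>2 / 2" using F(2) unfolding dist_real_def by linarith
  also have "\<dots> < e\<^sup>2" using e by simp
  finally have close: "h2_norm (\<lambda>p. f p - pser b p) < e"
    by (rule power2_less_imp_less) (use e in auto)
  have "cmod (pser b p) \<le> (\<Sum>k\<in>F. cmod (a k))" if p: "p \<in> bidisc" for p
  proof -
    have "pser b p = (\<Sum>k\<in>F. a k * monomial k p)"
      using p by (auto simp: pser_def b_def intro!: infsumI has_sum_finite_neutralI[OF F(1)])
    also have "cmod \<dots> \<le> (\<Sum>k\<in>F. cmod (a k) * 1)"
      using norm_monomial_le[of p 1] p
      by (intro sum_norm_le) (auto simp: norm_mult mem_Times_iff intro!: mult_left_le)
    finally show ?thesis by simp
  qed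
  then have "bounded (pser b ` bidisc)" by (auto simp: bounded_iff)
  then have "pser b \<in> hardy_inf"
    using pser_in_hardy2[OF b] unfolding hardy_inf_def hardy2_def by blast
  with that pser_in_hardy2[OF b] close show ?thesis by blast
qed

text \<open>The Szego kernel 1 / ((1 - cnj(fst q) z) (1 - cnj(snd q) w)) of the bidisc. In this form
  the inner product of f with it is literally the power series of f at q.\<close>

definition hardy_kernel :: "complex \<times> complex \<Rightarrow> complex \<times> complex \<Rightarrow> complex"
  where "hardy_kernel q = pser (\<lambda>k. cnj (monomial k q))"

lemma l2_kernel_coeffs:
  assumes "q \<in> bidisc"
  shows "l2 (\<lambda>k. cnj (monomial k q))"
proof -
  obtain r where r: "0 < r" "r < 1" "cmod (fst q) < r" "cmod (snd q) < r"
    using bidisc_radius[OF assms] .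
  have "(\<lambda>k. (r\<^sup>2) ^ deg k) summable_on UNIV"
    using r by (intro summable_geometric2) (auto simp: power_less_one_iff)
  then show ?thesis
    unfolding l2_def
  proof (rule summable_on_comparison_test)
    show "(cmod (cnj (monomial k q)))\<^sup>2 \<le> (r\<^sup>2) ^ deg k" for k
      using power_mono[OF norm_monomial_le[of q r k], of 2] r by (simp add: power_mult[symmetric] mult.commute)
  qed auto
qed

lemma hardy_kernel_in_hardy2: "q \<in> bidisc \<Longrightarrow> hardy_kernel q \<in> hardy2"
  unfolding hardy_kernel_def by (intro pser_in_hardy2 l2_kernel_coeffs)

lemma h2_inner_kernel:
  assumes "f \<in> hardy2" "q \<in> bidisc"
  shows "h2_inner f (hardy_kernel q) = f q"
proof -
  obtain a where a: "l2 a" "f = pser a" using assms(1) hardy2_obtain_coeffs by metis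
  then show ?thesis
    using assms(2) by (simp add: hardy_kernel_def h2_inner_pser l2_kernel_coeffs pser_def)
qed

text \<open>Testing the kernel against the constant function 1 and applying Cauchy-Schwarz gives 1
  \<le> \<open>h2_norm\<close> 1 times the norm of the kernel.\<close>

lemma hardy_kernel_norm_pos:
  assumes "q \<in> bidisc"
  shows "h2_norm (hardy_kernel q) > 0"
proof -
  have "pser (\<lambda>k. if k = (0, 0) then 1 else 0) q = 1"
    using assms by (auto simp: pser_def monomial_def intro!: infsumI has_sum_finite_neutralI[of "{(0, 0)}"] split: if_splits)
  moreover have "l2 (\<lambda>k::nat \<times> nat. if k = (0, 0) then 1 else 0)"
    unfolding l2_def by (rule has_sum_imp_summable, rule has_sum_finite_neutralI[of "{(0, 0)}"]) auto
  ultimately have "1 \<le> h2_norm (pser (\<lambda>k. if k = (0, 0) then 1 else 0)) * h2_norm (hardy_kernel q)"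
    using h2_Cauchy_Schwarz[OF pser_in_hardy2 hardy_kernel_in_hardy2[OF assms]]
      h2_inner_kernel[OF pser_in_hardy2 assms] by (metis norm_one)
  then show ?thesis
    using h2_norm_nonneg[OF hardy_kernel_in_hardy2[OF assms]] by (cases "h2_norm (hardy_kernel q) = 0") auto
qed

subsection \<open>Bounded holomorphic multipliers\<close>

lemma holomorphic2_add:
  assumes "holomorphic2_on f S" "holomorphic2_on g S"
  shows "holomorphic2_on (\<lambda>p. f p + g p) S"
proof -
  have "holomorphic2_on (\<lambda>p. 0) S"
    unfolding holomorphic2_on_def by (auto intro!: exI[of _ 0] simp: case_prod_unfold)
  from holomorphic2_diff[OF assms(1) holomorphic2_diff[OF this assms(2)]] show ?thesis by simp
qed

text \<open>Differs from \<open>hardy_inf\<close> by leaving the values off the bidisc free, so that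
  symbols such as constants, z - c or 1 / (z - l) can be used without truncation.\<close>

definition bounded_holomorphic2 :: "(complex \<times> complex \<Rightarrow> complex) \<Rightarrow> bool"
  where "bounded_holomorphic2 \<psi> \<longleftrightarrow> holomorphic2_on \<psi> bidisc \<and> bounded (\<psi> ` bidisc)"

lemma hardy_inf_iff:
  "h \<in> hardy_inf \<longleftrightarrow> bounded_holomorphic2 h \<and> (\<forall>p. p \<notin> bidisc \<longrightarrow> h p = 0)"
  unfolding hardy_inf_def bounded_holomorphic2_def by blast

lemma bounded_holomorphic2_obtain:
  assumes "bounded_holomorphic2 \<psi>"
  obtains B where "0 \<le> B" "\<And>p. p \<in> bidisc \<Longrightarrow> cmod (\<psi> p) \<le> B"
  using assms unfolding bounded_holomorphic2_def bounded_pos by (metis imageI less_imp_le)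

lemma bounded_holomorphic2_mult:
  assumes "bounded_holomorphic2 f" "bounded_holomorphic2 g"
  shows "bounded_holomorphic2 (\<lambda>p. f p * g p)"
proof -
  obtain B C where "0 \<le> B" "\<And>p. p \<in> bidisc \<Longrightarrow> cmod (f p) \<le> B" "\<And>p. p \<in> bidisc \<Longrightarrow> cmod (g p) \<le> C"
    using assms bounded_holomorphic2_obtain by metis
  then have "\<And>p. p \<in> bidisc \<Longrightarrow> cmod (f p * g p) \<le> B * C"
    unfolding norm_mult by (intro mult_mono) auto
  then have "bounded ((\<lambda>p. f p * g p) ` bidisc)"
    unfolding bounded_iff by blast
  then show ?thesis
    using assms by (simp add: bounded_holomorphic2_def holomorphic2_mult)
qed

lemma bounded_holomorphic2_add:
  assumes "bounded_holomorphic2 f" "bounded_holomorphic2 g"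
  shows "bounded_holomorphic2 (\<lambda>p. f p + g p)"
  using assms by (simp add: bounded_holomorphic2_def holomorphic2_add bounded_plus_comp)

lemma bounded_holomorphic2_fst:
  assumes "g holomorphic_on disc" "bounded (g ` disc)"
  shows "bounded_holomorphic2 (\<lambda>p. g (fst p))"
  unfolding bounded_holomorphic2_def
  by (intro conjI holomorphic2_fst assms(1) bounded_subset[OF assms(2)]) auto

lemma bounded_holomorphic2_snd:
  assumes "g holomorphic_on disc" "bounded (g ` disc)"
  shows "bounded_holomorphic2 (\<lambda>p. g (snd p))"
  unfolding bounded_holomorphic2_def
  by (intro conjI holomorphic2_snd assms(1) bounded_subset[OF assms(2)]) auto

lemma bounded_holomorphic2_const: "bounded_holomorphic2 (\<lambda>p. c)"
  by (rule bounded_holomorphic2_fst[of "\<lambda>_. c"]) (auto simp: bounded_iff)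

lemma bounded_holomorphic2_fst_diff: "bounded_holomorphic2 (\<lambda>p. fst p - c)"
proof (rule bounded_holomorphic2_fst)
  have "cmod (z - c) \<le> 1 + cmod c" if "z \<in> disc" for z
    using that norm_triangle_ineq4[of z c] by simp
  then show "bounded ((\<lambda>z. z - c) ` disc)" unfolding bounded_iff by blast
qed (intro holomorphic_intros)

text \<open>For the symbol (z - \<open>\<phi>\<close>(w)) / (\<open>\<phi>\<close>(w) - l), whose
  bounded form is algebraically equal to it only where the denominator is nonzero.\<close>

lemma bounded_holomorphic2_cong:
  assumes "bounded_holomorphic2 f" and eq: "\<And>p. p \<in> bidisc \<Longrightarrow> g p = f p"
  shows "bounded_holomorphic2 g"
proof -
  have "holomorphic2_on g bidisc"
    unfolding holomorphic2_on_def
  proof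
    fix p assume p: "p \<in> bidisc"
    then obtain a b where "(f has_derivative (\<lambda>(h, k). a * h + b * k)) (at p within bidisc)"
      using assms(1) unfolding bounded_holomorphic2_def holomorphic2_on_def by blast
    then have "(g has_derivative (\<lambda>(h, k). a * h + b * k)) (at p within bidisc)"
      by (rule has_derivative_transform[OF p eq, rotated])
    then show "\<exists>a b. (g has_derivative (\<lambda>(h, k). a * h + b * k)) (at p within bidisc)" by blast
  qed
  moreover have "g ` bidisc = f ` bidisc" by (rule image_cong[OF refl eq])
  ultimately show ?thesis using assms(1) by (simp add: bounded_holomorphic2_def)
qed

lemma hardy_inf_mult:
  "bounded_holomorphic2 \<psi> \<Longrightarrow> h \<in> hardy_inf \<Longrightarrow> (\<lambda>p. \<psi> p * h p) \<in> hardy_inf"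
  by (auto simp: hardy_inf_iff bounded_holomorphic2_mult simp del: mem_Times_iff)

lemma hardy_inf_add:
  "g \<in> hardy_inf \<Longrightarrow> h \<in> hardy_inf \<Longrightarrow> (\<lambda>p. g p + h p) \<in> hardy_inf"
  by (auto simp: hardy_inf_iff bounded_holomorphic2_add simp del: mem_Times_iff)

lemma hardy_inf_zero: "(\<lambda>_. 0) \<in> hardy_inf"
  by (simp add: hardy_inf_iff bounded_holomorphic2_const)

lemma hardy2_multiplier:
  assumes "bounded_holomorphic2 \<psi>" "f \<in> hardy2"
  shows "(\<lambda>p. \<psi> p * f p) \<in> hardy2"
  using assms bounded_holomorphic2_obtain hardy2_mult(1) unfolding bounded_holomorphic2_def by metis

section \<open>Closures of linear subspaces and square means of the generators\<close>

lemma closed_subspace_closure: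
  assumes A: "A \<subseteq> hardy2" "A \<noteq> {}"
    and add: "\<And>f g. f \<in> A \<Longrightarrow> g \<in> A \<Longrightarrow> (\<lambda>p. f p + g p) \<in> A"
    and cmult: "\<And>c f. f \<in> A \<Longrightarrow> (\<lambda>p. c * f p) \<in> A"
  shows "closed_subspace (h2_closure A)" "A \<subseteq> h2_closure A"
proof -
  have zero: "h2_norm (\<lambda>p. f p - f p) = 0" if "f \<in> hardy2" for f
    using h2_norm_cmult[OF that, of 0] by simp
  show sub: "A \<subseteq> h2_closure A"
    unfolding h2_closure_def using A(1) zero by force
  show "closed_subspace (h2_closure A)"
    unfolding closed_subspace_def
  proof (intro conjI ballI allI impI)
    show "h2_closure A \<subseteq> hardy2" by (auto simp: h2_closure_def)
    show "h2_closure A \<noteq> {}" using sub A(2) by blast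
  next
    fix f g assume fg: "f \<in> h2_closure A" "g \<in> h2_closure A"
    then have H: "f \<in> hardy2" "g \<in> hardy2" by (auto simp: h2_closure_def)
    have "\<exists>x\<in>A. h2_norm (\<lambda>p. f p + g p - x p) < e" if e: "e > 0" for e
    proof -
      obtain u v where uv: "u \<in> A" "v \<in> A" "h2_norm (\<lambda>p. f p - u p) < e / 2" "h2_norm (\<lambda>p. g p - v p) < e / 2"
        using fg half_gt_zero[OF e] unfolding h2_closure_def by blast
      then have "u \<in> hardy2" "v \<in> hardy2" using A(1) by auto
      from h2_norm_triangle[OF hardy2_diff[OF H(1) this(1)] hardy2_diff[OF H(2) this(2)]] uv
      have "h2_norm (\<lambda>p. f p + g p - (u p + v p)) < e" by (simp add: algebra_simps)
      then show ?thesis by (rule bexI[OF _ add[OF uv(1,2)]])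
    qed
    then show "(\<lambda>p. f p + g p) \<in> h2_closure A"
      using H by (simp add: h2_closure_def hardy2_add)
  next
    fix c f assume f: "f \<in> h2_closure A"
    then have H: "f \<in> hardy2" by (auto simp: h2_closure_def)
    have "\<exists>x\<in>A. h2_norm (\<lambda>p. c * f p - x p) < e" if e: "e > 0" for e
    proof -
      \<comment> \<open>Adding 1 avoids a division by zero when c = 0.\<close>
      have "e / (cmod c + 1) > 0" using e by (simp add: add_nonneg_pos)
      then obtain u where u: "u \<in> A" "h2_norm (\<lambda>p. f p - u p) < e / (cmod c + 1)"
        using f unfolding h2_closure_def by blast
      have d: "(\<lambda>p. f p - u p) \<in> hardy2" using H u A(1) by (auto intro: hardy2_diff)
      have "h2_norm (\<lambda>p. c * f p - c * u p) = cmod c * h2_norm (\<lambda>p. f p - u p)"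
        using h2_norm_cmult[OF d, of c] by (simp add: right_diff_distrib)
      also have "\<dots> \<le> (cmod c + 1) * h2_norm (\<lambda>p. f p - u p)"
        by (intro mult_right_mono h2_norm_nonneg d) auto
      also have "\<dots> < e" using u(2) by (simp add: pos_less_divide_eq add_nonneg_pos mult.commute)
      finally show ?thesis by (rule bexI[OF _ cmult[OF u(1)]])
    qed
    then show "(\<lambda>p. c * f p) \<in> h2_closure A"
      using H by (simp add: h2_closure_def hardy2_cmult)
  next
    fix f assume f: "f \<in> hardy2" "\<forall>e>0. \<exists>g\<in>h2_closure A. h2_norm (\<lambda>p. f p - g p) < e"
    have "\<exists>x\<in>A. h2_norm (\<lambda>p. f p - x p) < e" if e: "e > 0" for e
    proof -
      obtain g where g: "g \<in> h2_closure A" "h2_norm (\<lambda>p. f p - g p) < e / 2"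
        using f(2) half_gt_zero[OF e] by blast
      obtain x where x: "x \<in> A" "h2_norm (\<lambda>p. g p - x p) < e / 2"
        using g(1) half_gt_zero[OF e] unfolding h2_closure_def by blast
      have "g \<in> hardy2" "x \<in> hardy2" using g x A(1) by (auto simp: h2_closure_def)
      from h2_norm_triangle_diff[OF f(1) this] g(2) x(2) show ?thesis by (intro bexI[OF _ x(1)]) linarith
    qed
    then show "f \<in> h2_closure A" using f(1) by (simp add: h2_closure_def)
  qed
qed

text \<open>Carries the hypothesis on \<open>\<phi>\<close>, which is stated by means over circles,
  to means over tori.\<close>

lemma torus_mean_snd:
  fixes v :: "complex \<Rightarrow> real"
  assumes "continuous_on disc v" "0 \<le> r" "r < 1"
  shows "torus_mean r (\<lambda>p. v (snd p)) = circle_mean r v"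
proof -
  have "continuous_on bidisc (\<lambda>p. v (snd p))"
    by (rule continuous_on_compose2[OF assms(1)]) (auto intro!: continuous_intros)
  then have "continuous_on period_box (\<lambda>x. v (snd (torus_pt r x)))"
    using assms by (intro continuous_on_bidisc_torus_pt[of "\<lambda>p. v (snd p)"]) auto
  then have "integral period_box (\<lambda>x. v (snd (torus_pt r x))) =
      integral {0..2*pi} (\<lambda>s. integral {0..2*pi} (\<lambda>t. v (snd (torus_pt r (s, t)))))"
    by (subst integral_prod_continuous) auto
  also have "\<dots> = 2 * pi * integral {0..2*pi} (\<lambda>t. v (of_real r * cis t))"
    by (simp add: torus_pt_def)
  finally show ?thesis
    by (simp add: torus_mean_alt circle_mean_def power2_eq_square field_simps)
qed

text \<open>With h bounded by B, the squared modulus of the product is at most (2 + 2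
  |\<open>\<phi>\<close>|^2) B^2, whose means are controlled by the quadratic means of
  \<open>\<phi>\<close>.\<close>

lemma generator_in_hardy2:
  assumes phi: "\<phi> \<in> hardy2_disc" and h: "h \<in> hardy_inf"
  shows "(\<lambda>p. (fst p - \<phi> (snd p)) * h p) \<in> hardy2"
proof -
  have hol: "\<phi> holomorphic_on disc" using phi by (simp add: hardy2_disc_def)
  have c\<phi>: "continuous_on disc \<phi>" using hol by (rule holomorphic_on_imp_continuous_on)
  have "bounded_holomorphic2 h" using h by (simp add: hardy_inf_iff)
  then obtain B where B: "0 \<le> B" "\<And>p. p \<in> bidisc \<Longrightarrow> cmod (h p) \<le> B"
    and hh: "holomorphic2_on h bidisc"
    using bounded_holomorphic2_obtain bounded_holomorphic2_def by metis
  have "bdd_above ((\<lambda>r. circle_mean r (\<lambda>w. (cmod (\<phi> w))\<^sup>2)) ` {0<..<1})"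
    using phi unfolding hardy2_disc_def by simp
  then obtain K where K: "\<And>r. r \<in> {0<..<1} \<Longrightarrow> circle_mean r (\<lambda>w. (cmod (\<phi> w))\<^sup>2) \<le> K"
    unfolding bdd_above_def by blast
  have hol2: "holomorphic2_on (\<lambda>p. (fst p - \<phi> (snd p)) * h p) bidisc"
    by (intro holomorphic2_mult holomorphic2_diff holomorphic2_fst[of "\<lambda>z. z"] holomorphic2_snd hol hh
        holomorphic_intros)
  show ?thesis
  proof (rule hardy2I[OF hol2])
    show "(fst p - \<phi> (snd p)) * h p = 0" if "p \<notin> bidisc" for p
      using h that unfolding hardy_inf_iff mult_eq_0_iff by blast
  next
    fix r :: real assume r: "0 < r" "r < 1"
    let ?v = "\<lambda>w. 2 * B\<^sup>2 + 2 * B\<^sup>2 * (cmod (\<phi> w))\<^sup>2"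
    have cv: "continuous_on disc ?v" by (intro continuous_intros c\<phi>)
    have "torus_mean r (\<lambda>p. (cmod ((fst p - \<phi> (snd p)) * h p))\<^sup>2) \<le> torus_mean r (\<lambda>p. ?v (snd p))"
    proof (rule torus_mean_mono)
      show "continuous_on bidisc (\<lambda>p. (cmod ((fst p - \<phi> (snd p)) * h p))\<^sup>2)"
        by (intro continuous_intros holomorphic2_continuous_on[OF hol2])
      show "continuous_on bidisc (\<lambda>p. ?v (snd p))"
        by (rule continuous_on_compose2[OF cv]) (auto intro!: continuous_intros)
      fix p :: "complex \<times> complex" assume p: "p \<in> bidisc"
      have "cmod (fst p) \<le> 1" using p by (auto simp: mem_Times_iff)
      then have "(cmod (fst p))\<^sup>2 \<le> 1" by (simp add: power_le_one)
      have "(cmod (fst p - \<phi> (snd p)))\<^sup>2 \<le> (cmod (fst p) + cmod (\<phi> (snd p)))\<^sup>2"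
        by (intro power_mono norm_triangle_ineq4) auto
      also have "\<dots> \<le> 2 + 2 * (cmod (\<phi> (snd p)))\<^sup>2"
        using sum_squares_bound[of "cmod (fst p)" "cmod (\<phi> (snd p))"] \<open>(cmod (fst p))\<^sup>2 \<le> 1\<close>
        by (simp add: power2_sum)
      finally have "(cmod (fst p - \<phi> (snd p)))\<^sup>2 * (cmod (h p))\<^sup>2 \<le> (2 + 2 * (cmod (\<phi> (snd p)))\<^sup>2) * B\<^sup>2"
        using B(2)[OF p] by (intro mult_mono power_mono) auto
      then show "(cmod ((fst p - \<phi> (snd p)) * h p))\<^sup>2 \<le> ?v (snd p)"
        unfolding norm_mult power_mult_distrib by (simp add: algebra_simps)
    qed (use r in auto)
    also have "\<dots> = circle_mean r ?v" using r by (intro torus_mean_snd cv) auto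
    also have "\<dots> = 2 * B\<^sup>2 + 2 * B\<^sup>2 * circle_mean r (\<lambda>w. (cmod (\<phi> w))\<^sup>2)"
    proof -
      have "continuous_on {0..2*pi} (\<lambda>t. (cmod (\<phi> (of_real r * cis t)))\<^sup>2)"
        by (intro continuous_intros continuous_on_compose2[OF c\<phi>]) (use r in \<open>auto simp: norm_mult\<close>)
      then have "integral {0..2*pi} (\<lambda>t. ?v (of_real r * cis t)) = 2 * pi * (2 * B\<^sup>2) +
          2 * B\<^sup>2 * integral {0..2*pi} (\<lambda>t. (cmod (\<phi> (of_real r * cis t)))\<^sup>2)"
        by (subst integral_add) (auto intro!: integrable_continuous_real continuous_intros)
      then show ?thesis by (simp add: circle_mean_def field_simps)
    qed
    also have "\<dots> \<le> 2 * B\<^sup>2 + 2 * B\<^sup>2 * K"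
      using K[of r] r by (intro add_left_mono mult_left_mono) auto
    finally show "torus_mean r (\<lambda>p. (cmod ((fst p - \<phi> (snd p)) * h p))\<^sup>2) \<le> 2 * B\<^sup>2 + 2 * B\<^sup>2 * K" .
  qed
qed

subsection \<open>The quotient module and its compressed shift\<close>

context
  fixes \<phi> :: "complex \<Rightarrow> complex"
  assumes phi: "\<phi> \<in> hardy2_disc"
begin

private lemma M_space_alt:
  "M_space \<phi> = h2_closure ((\<lambda>h p. (fst p - \<phi> (snd p)) * h p) ` hardy_inf)"
  by (simp add: M_space_def case_prod_unfold)

lemma M_space_closed_subspace: "closed_subspace (M_space \<phi>)"
  and generator_in_M_space: "h \<in> hardy_inf \<Longrightarrow> (\<lambda>p. (fst p - \<phi> (snd p)) * h p) \<in> M_space \<phi>"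
proof -
  let ?A = "(\<lambda>h p. (fst p - \<phi> (snd p)) * h p) ` hardy_inf"
  have 1: "?A \<subseteq> hardy2" using generator_in_hardy2[OF phi] by blast
  have 2: "?A \<noteq> {}" using hardy_inf_zero by blast
  have 3: "(\<lambda>p. f p + g p) \<in> ?A" if fg: "f \<in> ?A" "g \<in> ?A" for f g
  proof -
    obtain u v where uv: "u \<in> hardy_inf" "v \<in> hardy_inf"
      "f = (\<lambda>p. (fst p - \<phi> (snd p)) * u p)" "g = (\<lambda>p. (fst p - \<phi> (snd p)) * v p)"
      using fg by blast
    then have "(\<lambda>p. f p + g p) = (\<lambda>p. (fst p - \<phi> (snd p)) * (u p + v p))"
      by (simp add: distrib_left)
    then show ?thesis using hardy_inf_add[OF uv(1,2)] by (rule image_eqI)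
  qed
  have 4: "(\<lambda>p. c * f p) \<in> ?A" if f: "f \<in> ?A" for c f
  proof -
    obtain u where u: "u \<in> hardy_inf" "f = (\<lambda>p. (fst p - \<phi> (snd p)) * u p)" using f by blast
    then have "(\<lambda>p. c * f p) = (\<lambda>p. (fst p - \<phi> (snd p)) * (c * u p))" by (simp add: mult.left_commute)
    then show ?thesis using hardy_inf_mult[OF bounded_holomorphic2_const u(1)] by (rule image_eqI)
  qed
  show "closed_subspace (M_space \<phi>)"
    unfolding M_space_alt by (rule closed_subspace_closure(1)[OF 1 2 3 4])
  show "h \<in> hardy_inf \<Longrightarrow> (\<lambda>p. (fst p - \<phi> (snd p)) * h p) \<in> M_space \<phi>"
    using closed_subspace_closure(2)[OF 1 2 3 4] unfolding M_space_alt by blast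
qed

lemmas M_space_hardy2 = closed_subspaceD(1)[OF M_space_closed_subspace]
lemmas M_space_add = closed_subspaceD(3)[OF M_space_closed_subspace]
lemmas M_space_cmult = closed_subspaceD(4)[OF M_space_closed_subspace]
lemmas M_space_closed = closed_subspaceD(5)[OF M_space_closed_subspace]

lemma M_space_diff: "f \<in> M_space \<phi> \<Longrightarrow> g \<in> M_space \<phi> \<Longrightarrow> (\<lambda>p. f p - g p) \<in> M_space \<phi>"
  using M_space_add[of f "\<lambda>p. -1 * g p"] M_space_cmult[of g "-1"] by simp

lemma M_space_approx:
  assumes "f \<in> M_space \<phi>" "e > 0"
  obtains h where "h \<in> hardy_inf" "h2_norm (\<lambda>p. f p - (fst p - \<phi> (snd p)) * h p) < e"
  using assms unfolding M_space_alt h2_closure_def by blast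

text \<open>A bounded multiplier sends generators to generators, since it preserves
  \<open>hardy_inf\<close>, and it is continuous in norm, so the closure is invariant as
  well.\<close>

lemma M_space_mult:
  assumes psi: "bounded_holomorphic2 \<psi>" and f: "f \<in> M_space \<phi>"
  shows "(\<lambda>p. \<psi> p * f p) \<in> M_space \<phi>"
proof (rule M_space_closed)
  note fH = M_space_hardy2[OF f]
  show "(\<lambda>p. \<psi> p * f p) \<in> hardy2" by (rule hardy2_multiplier[OF psi fH])
  fix e :: real assume e: "e > 0"
  obtain B where B: "0 \<le> B" "\<And>p. p \<in> bidisc \<Longrightarrow> cmod (\<psi> p) \<le> B"
    using bounded_holomorphic2_obtain[OF psi] by blast
  have "e / (B + 1) > 0" using e B by simp
  then obtain h where h: "h \<in> hardy_inf" "h2_norm (\<lambda>p. f p - (fst p - \<phi> (snd p)) * h p) < e / (B + 1)"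
    using M_space_approx[OF f] by blast
  let ?g = "\<lambda>p. (fst p - \<phi> (snd p)) * (\<psi> p * h p)"
  have d: "(\<lambda>p. f p - (fst p - \<phi> (snd p)) * h p) \<in> hardy2"
    by (intro hardy2_diff fH generator_in_hardy2 phi h)
  have "(\<lambda>p. \<psi> p * f p - ?g p) = (\<lambda>p. \<psi> p * (f p - (fst p - \<phi> (snd p)) * h p))"
    by (simp add: algebra_simps)
  then have "h2_norm (\<lambda>p. \<psi> p * f p - ?g p) \<le> B * h2_norm (\<lambda>p. f p - (fst p - \<phi> (snd p)) * h p)"
    using hardy2_mult(2)[of \<psi> B, OF _ B(2) d] psi by (simp add: bounded_holomorphic2_def)
  also have "\<dots> \<le> (B + 1) * h2_norm (\<lambda>p. f p - (fst p - \<phi> (snd p)) * h p)"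
    by (intro mult_right_mono h2_norm_nonneg d) simp
  also have "\<dots> < e" using h(2) B by (simp add: pos_less_divide_eq mult.commute)
  finally show "\<exists>g\<in>M_space \<phi>. h2_norm (\<lambda>p. \<psi> p * f p - g p) < e"
    by (rule bexI[OF _ generator_in_M_space[OF hardy_inf_mult[OF psi h(1)]]])
qed

text \<open>A bounded multiple of \<open>z - \<phi>\<close> maps all of \<open>hardy2\<close>, not only \<open>hardy_inf\<close>, into
  \<open>M_space \<phi>\<close>, because \<open>hardy_inf\<close> is dense.\<close>

lemma bounded_multiple_in_M_space:
  assumes psi: "bounded_holomorphic2 \<psi>"
    and q: "bounded_holomorphic2 (\<lambda>p. (fst p - \<phi> (snd p)) * \<psi> p)"
    and f: "f \<in> hardy2"
  shows "(\<lambda>p. (fst p - \<phi> (snd p)) * \<psi> p * f p) \<in> M_space \<phi>"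
proof (rule M_space_closed)
  show "(\<lambda>p. (fst p - \<phi> (snd p)) * \<psi> p * f p) \<in> hardy2" by (rule hardy2_multiplier[OF q f])
  fix e :: real assume e: "e > 0"
  obtain B where B: "0 \<le> B" "\<And>p. p \<in> bidisc \<Longrightarrow> cmod ((fst p - \<phi> (snd p)) * \<psi> p) \<le> B"
    using bounded_holomorphic2_obtain[OF q] by blast
  have "e / (B + 1) > 0" using e B by simp
  then obtain h where h: "h \<in> hardy_inf" "h \<in> hardy2" "h2_norm (\<lambda>p. f p - h p) < e / (B + 1)"
    using hardy_inf_dense[OF f] by blast
  let ?g = "\<lambda>p. (fst p - \<phi> (snd p)) * (\<psi> p * h p)"
  have d: "(\<lambda>p. f p - h p) \<in> hardy2" by (intro hardy2_diff f h)
  have "(\<lambda>p. (fst p - \<phi> (snd p)) * \<psi> p * f p - ?g p) = (\<lambda>p. (fst p - \<phi> (snd p)) * \<psi> p * (f p - h p))"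
    by (simp add: algebra_simps)
  then have "h2_norm (\<lambda>p. (fst p - \<phi> (snd p)) * \<psi> p * f p - ?g p) \<le> B * h2_norm (\<lambda>p. f p - h p)"
    using hardy2_mult(2)[of "\<lambda>p. (fst p - \<phi> (snd p)) * \<psi> p" B, OF _ B(2) d] q
    by (simp add: bounded_holomorphic2_def)
  also have "\<dots> \<le> (B + 1) * h2_norm (\<lambda>p. f p - h p)"
    by (intro mult_right_mono h2_norm_nonneg d) simp
  also have "\<dots> < e" using h(3) B by (simp add: pos_less_divide_eq mult.commute)
  finally show "\<exists>g\<in>M_space \<phi>. h2_norm (\<lambda>p. (fst p - \<phi> (snd p)) * \<psi> p * f p - g p) < e"
    by (rule bexI[OF _ generator_in_M_space[OF hardy_inf_mult[OF psi h(1)]]])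
qed

text \<open>All generators vanish on the graph z = \<open>\<phi>\<close>(w), and evaluation at a
  point of the bidisc is continuous by the reproducing kernel.\<close>

lemma M_space_vanishes:
  assumes f: "f \<in> M_space \<phi>" and b: "b \<in> disc" "\<phi> b \<in> disc"
  shows "f (\<phi> b, b) = 0"
proof (rule ccontr)
  assume nz: "f (\<phi> b, b) \<noteq> 0"
  have q: "(\<phi> b, b) \<in> bidisc" using b by simp
  let ?k = "h2_norm (hardy_kernel (\<phi> b, b))"
  have k: "?k > 0" by (rule hardy_kernel_norm_pos[OF q])
  \<comment> \<open>An approximation closer than this quotient would, by Cauchy-Schwarz, change the
    value at the point by less than |\<open>f (\<phi> b, b)\<close>|, although the generator is 0
    there.\<close>
  have "cmod (f (\<phi> b, b)) / ?k > 0" using nz k by simp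
  then obtain h where h: "h \<in> hardy_inf"
    "h2_norm (\<lambda>p. f p - (fst p - \<phi> (snd p)) * h p) < cmod (f (\<phi> b, b)) / ?k"
    using M_space_approx[OF f] by blast
  have d: "(\<lambda>p. f p - (fst p - \<phi> (snd p)) * h p) \<in> hardy2"
    by (intro hardy2_diff M_space_hardy2 f generator_in_hardy2 phi h)
  have "cmod (f (\<phi> b, b)) \<le> h2_norm (\<lambda>p. f p - (fst p - \<phi> (snd p)) * h p) * ?k"
    using h2_Cauchy_Schwarz[OF d hardy_kernel_in_hardy2[OF q]] h2_inner_kernel[OF d q] by simp
  then show False using h(2) k by (simp add: pos_less_divide_eq)
qed

section \<open>The orthogonal complement and its projection\<close>

lemma N_space_hardy2: "f \<in> N_space \<phi> \<Longrightarrow> f \<in> hardy2"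
  by (simp add: N_space_def)

lemma N_space_add: "f \<in> N_space \<phi> \<Longrightarrow> g \<in> N_space \<phi> \<Longrightarrow> (\<lambda>p. f p + g p) \<in> N_space \<phi>"
  by (simp add: N_space_def hardy2_add h2_inner_add_left M_space_hardy2)

lemma N_space_cmult: "f \<in> N_space \<phi> \<Longrightarrow> (\<lambda>p. c * f p) \<in> N_space \<phi>"
  by (simp add: N_space_def hardy2_cmult h2_inner_cmult_left M_space_hardy2)

lemma N_space_diff: "f \<in> N_space \<phi> \<Longrightarrow> g \<in> N_space \<phi> \<Longrightarrow> (\<lambda>p. f p - g p) \<in> N_space \<phi>"
  by (simp add: N_space_def hardy2_diff h2_inner_diff_left M_space_hardy2)

lemma M_N_space_inner: "f \<in> M_space \<phi> \<Longrightarrow> g \<in> N_space \<phi> \<Longrightarrow> h2_inner f g = 0"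
  using h2_inner_commute[of g f] by (simp add: N_space_def M_space_hardy2)

lemma M_N_space_disjoint:
  assumes "f \<in> M_space \<phi>" "f \<in> N_space \<phi>"
  shows "f = (\<lambda>_. 0)"
  using M_N_space_inner[OF assms] h2_inner_self[OF N_space_hardy2[OF assms(2)]]
    h2_norm_eq_0D[OF N_space_hardy2[OF assms(2)]] by simp

text \<open>Replaces the definite description by the condition that the error lies in
  \<open>M_space \<phi>\<close>, which algebra with multipliers delivers directly. Uniqueness holds
  because the difference of two candidates lies in \<open>N_space \<phi>\<close> and is orthogonal
  to itself.\<close>

lemma orth_proj_eqI:
  assumes f: "f \<in> hardy2" and g: "g \<in> N_space \<phi>" and M: "(\<lambda>p. f p - g p) \<in> M_space \<phi>"
  shows "orth_proj (N_space \<phi>) f = g"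
  unfolding orth_proj_def
proof (rule the_equality)
  show "g \<in> N_space \<phi> \<and> (\<forall>h\<in>N_space \<phi>. h2_inner (\<lambda>p. f p - g p) h = 0)"
    using g M_N_space_inner[OF M] by blast
next
  fix u assume u: "u \<in> N_space \<phi> \<and> (\<forall>h\<in>N_space \<phi>. h2_inner (\<lambda>p. f p - u p) h = 0)"
  let ?d = "\<lambda>p. u p - g p"
  have d: "?d \<in> N_space \<phi>" using u g N_space_diff by blast
  have "h2_inner (\<lambda>p. (f p - g p) - (f p - u p)) ?d = 0"
    using u d f g M_N_space_inner[OF M d]
    by (subst h2_inner_diff_left) (auto intro: hardy2_diff N_space_hardy2)
  then have "h2_inner ?d ?d = 0" by simp
  then have "?d = (\<lambda>_. 0)"
    using h2_inner_self[OF N_space_hardy2[OF d]] h2_norm_eq_0D[OF N_space_hardy2[OF d]] by simp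
  then show "u = g" by (simp add: fun_eq_iff)
qed

text \<open>Existence is obtained by projecting onto the closed subspace
  \<open>M_space \<phi>\<close> and taking the remainder, which gives at once that the error lies in
  \<open>M_space \<phi>\<close>.\<close>

lemma orth_proj_N_space:
  assumes "f \<in> hardy2"
  shows "orth_proj (N_space \<phi>) f \<in> N_space \<phi>" "(\<lambda>p. f p - orth_proj (N_space \<phi>) f p) \<in> M_space \<phi>"
proof -
  obtain m where m: "m \<in> M_space \<phi>" "\<And>x. x \<in> M_space \<phi> \<Longrightarrow> h2_inner (\<lambda>p. f p - m p) x = 0"
    using projection_exists[OF M_space_closed_subspace assms] by blast
  have n: "(\<lambda>p. f p - m p) \<in> N_space \<phi>"
    using m assms by (simp add: N_space_def hardy2_diff M_space_hardy2)
  have "orth_proj (N_space \<phi>) f = (\<lambda>p. f p - m p)"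
    by (rule orth_proj_eqI[OF assms n]) (simp add: m)
  then show "orth_proj (N_space \<phi>) f \<in> N_space \<phi>" "(\<lambda>p. f p - orth_proj (N_space \<phi>) f p) \<in> M_space \<phi>"
    using n m(1) by simp_all
qed

lemma h2_norm_orth_proj_le:
  assumes "f \<in> hardy2"
  shows "h2_norm (orth_proj (N_space \<phi>) f) \<le> h2_norm f"
proof (rule power2_le_imp_le)
  let ?n = "orth_proj (N_space \<phi>) f"
  let ?m = "\<lambda>p. f p - ?n p"
  note P = orth_proj_N_space[OF assms]
  have "h2_inner ?m ?n = 0" by (rule M_N_space_inner[OF P(2,1)])
  then show "(h2_norm ?n)\<^sup>2 \<le> (h2_norm f)\<^sup>2"
    using h2_norm_add_sq[OF M_space_hardy2[OF P(2)] N_space_hardy2[OF P(1)]] by simp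
qed (rule h2_norm_nonneg[OF assms])

section \<open>The compressed shift and its resolvents\<close>

lemma shift_in_hardy2: "f \<in> hardy2 \<Longrightarrow> (\<lambda>p. fst p * f p) \<in> hardy2"
  using hardy2_multiplier[OF bounded_holomorphic2_fst_diff[of 0]] by simp

lemma S_z_N_space:
  assumes "f \<in> N_space \<phi>"
  shows "S_z \<phi> f \<in> N_space \<phi>" "(\<lambda>p. fst p * f p - S_z \<phi> f p) \<in> M_space \<phi>"
  using orth_proj_N_space[OF shift_in_hardy2[OF N_space_hardy2[OF assms]]]
  by (simp_all add: S_z_def case_prod_unfold)

text \<open>Both resolvent identities hold modulo \<open>M_space \<phi>\<close>, because that space
  absorbs the projection errors even after multiplication by \<open>\<psi>\<close> or by z - l.
  Elements of \<open>N_space \<phi>\<close> that agree modulo \<open>M_space \<phi>\<close> are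
  equal.\<close>

lemma not_in_spectrumI:
  assumes psi: "bounded_holomorphic2 \<psi>"
    and inv: "\<And>f. f \<in> hardy2 \<Longrightarrow> (\<lambda>p. (fst p - l) * \<psi> p * f p - f p) \<in> M_space \<phi>"
  shows "l \<notin> op_spectrum (N_space \<phi>) (S_z \<phi>)"
proof -
  define R where "R f = orth_proj (N_space \<phi>) (\<lambda>p. \<psi> p * f p)" for f
  obtain B where B: "0 \<le> B" "\<And>p. p \<in> bidisc \<Longrightarrow> cmod (\<psi> p) \<le> B"
    using bounded_holomorphic2_obtain[OF psi] by blast
  note psiH = hardy2_multiplier[OF psi]
  have R: "R f \<in> N_space \<phi>" "(\<lambda>p. \<psi> p * f p - R f p) \<in> M_space \<phi>" if "f \<in> hardy2" for f
    using orth_proj_N_space[OF psiH[OF that]] by (simp_all add: R_def)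
  have "bounded_op (N_space \<phi>) R"
    unfolding bounded_op_def
  proof (intro conjI ballI allI)
    fix f g assume "f \<in> N_space \<phi>" "g \<in> N_space \<phi>"
    then have H: "f \<in> hardy2" "g \<in> hardy2" by (auto intro: N_space_hardy2)
    show "R (\<lambda>p. f p + g p) = (\<lambda>p. R f p + R g p)"
      unfolding R_def[of "\<lambda>p. f p + g p"]
    proof (rule orth_proj_eqI)
      show "(\<lambda>p. \<psi> p * (f p + g p) - (R f p + R g p)) \<in> M_space \<phi>"
        using M_space_add[OF R(2)[OF H(1)] R(2)[OF H(2)]] by (simp add: algebra_simps)
    qed (intro psiH hardy2_add H N_space_add R)+
  next
    fix c f assume "f \<in> N_space \<phi>"
    then have H: "f \<in> hardy2" by (rule N_space_hardy2)
    show "R (\<lambda>p. c * f p) = (\<lambda>p. c * R f p)"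
      unfolding R_def[of "\<lambda>p. c * f p"]
    proof (rule orth_proj_eqI)
      show "(\<lambda>p. \<psi> p * (c * f p) - c * R f p) \<in> M_space \<phi>"
        using M_space_cmult[OF R(2)[OF H], of c] by (simp add: algebra_simps)
    qed (intro psiH hardy2_cmult H N_space_cmult R)+
  next
    have "h2_norm (R f) \<le> B * h2_norm f" if "f \<in> N_space \<phi>" for f
    proof -
      have H: "f \<in> hardy2" using that by (rule N_space_hardy2)
      have "h2_norm (R f) \<le> h2_norm (\<lambda>p. \<psi> p * f p)"
        unfolding R_def by (rule h2_norm_orth_proj_le[OF psiH[OF H]])
      also have "\<dots> \<le> B * h2_norm f"
        using hardy2_mult(2)[of \<psi> B, OF _ B(2) H] psi by (simp add: bounded_holomorphic2_def)
      finally show ?thesis .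
    qed
    then show "\<exists>C. \<forall>f\<in>N_space \<phi>. h2_norm (R f) \<le> C * h2_norm f" by blast
  qed (intro R N_space_hardy2)
  moreover have "R (\<lambda>p. S_z \<phi> f p - l * f p) = f" if f: "f \<in> N_space \<phi>" for f
    unfolding R_def
  proof (rule orth_proj_eqI)
    note H = N_space_hardy2[OF f]
    show "(\<lambda>p. \<psi> p * (S_z \<phi> f p - l * f p)) \<in> hardy2"
      by (intro psiH hardy2_diff hardy2_cmult H N_space_hardy2 S_z_N_space f)
    \<comment> \<open>This function is ((z - l) \<open>\<psi>\<close> f - f) - \<open>\<psi>\<close>
      (z f - \<open>S_z\<close> f), a difference of two elements of
      \<open>M_space \<phi>\<close>.\<close>
    show "(\<lambda>p. \<psi> p * (S_z \<phi> f p - l * f p) - f p) \<in> M_space \<phi>"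
      using M_space_diff[OF inv[OF H] M_space_mult[OF psi S_z_N_space(2)[OF f]]]
      by (simp add: algebra_simps)
  qed (rule f)
  moreover have "(\<lambda>p. S_z \<phi> (R f) p - l * R f p) = f" if f: "f \<in> N_space \<phi>" for f
  proof -
    note H = N_space_hardy2[OF f]
    \<comment> \<open>The combination is chosen so that all terms containing \<open>\<psi>\<close>
      or z cancel, leaving f - (\<open>S_z\<close> (R f) - l R f).\<close>
    have "(\<lambda>p. (fst p - l) * (\<psi> p * f p - R f p) + (fst p * R f p - S_z \<phi> (R f) p)
        - ((fst p - l) * \<psi> p * f p - f p)) \<in> M_space \<phi>"
      by (intro M_space_diff M_space_add inv H M_space_mult[OF bounded_holomorphic2_fst_diff] R S_z_N_space)
    then have "(\<lambda>p. f p - (S_z \<phi> (R f) p - l * R f p)) \<in> M_space \<phi>"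
      by (simp add: algebra_simps)
    moreover have "(\<lambda>p. f p - (S_z \<phi> (R f) p - l * R f p)) \<in> N_space \<phi>"
      by (intro N_space_diff N_space_cmult f S_z_N_space R H)
    ultimately have "(\<lambda>p. f p - (S_z \<phi> (R f) p - l * R f p)) = (\<lambda>_. 0)"
      by (rule M_N_space_disjoint)
    then show ?thesis by (simp add: fun_eq_iff)
  qed
  ultimately show ?thesis unfolding op_spectrum_def by blast
qed

section \<open>The two inclusions for the spectrum\<close>

lemma spectrum_subset_closed_disc:
  assumes "cmod l > 1"
  shows "l \<notin> op_spectrum (N_space \<phi>) (S_z \<phi>)"
proof (rule not_in_spectrumI)
  have ge: "cmod (z - l) \<ge> cmod l - 1" if "z \<in> disc" for z
    using that norm_triangle_ineq2[of l z] by (simp add: norm_minus_commute)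
  then have nz: "z - l \<noteq> 0" if "z \<in> disc" for z using that assms by force
  have "cmod (1 / (z - l)) \<le> 1 / (cmod l - 1)" if "z \<in> disc" for z
    using ge[OF that] assms by (simp add: norm_divide frac_le)
  then have "bounded ((\<lambda>z. 1 / (z - l)) ` disc)" unfolding bounded_iff by blast
  then show "bounded_holomorphic2 (\<lambda>p. 1 / (fst p - l))"
    by (intro bounded_holomorphic2_fst[of "\<lambda>z. 1 / (z - l)"] holomorphic_intros nz)
  fix f assume f: "f \<in> hardy2"
  have "(fst p - l) * (1 / (fst p - l)) * f p - f p = 0" for p
    using nz[of "fst p"] hardy2_vanishes[OF f, of p] by (cases "p \<in> bidisc") (auto simp: mem_Times_iff)
  \<comment> \<open>The zero function is written as a generator, with h = 0, to place it in
    \<open>M_space \<phi>\<close>.\<close>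
  then have "(\<lambda>p. (fst p - l) * (1 / (fst p - l)) * f p - f p) = (\<lambda>p. (fst p - \<phi> (snd p)) * 0)"
    by (simp only: mult_zero_right)
  then show "(\<lambda>p. (fst p - l) * (1 / (fst p - l)) * f p - f p) \<in> M_space \<phi>"
    using generator_in_M_space[OF hardy_inf_zero] by simp
qed

lemma spectrum_subset_closure_range:
  assumes "l \<notin> closure (\<phi> ` disc)"
  shows "l \<notin> op_spectrum (N_space \<phi>) (S_z \<phi>)"
proof (rule not_in_spectrumI)
  have hol: "\<phi> holomorphic_on disc" using phi by (simp add: hardy2_disc_def)
  obtain d where d: "d > 0" "\<And>w. w \<in> disc \<Longrightarrow> d \<le> cmod (\<phi> w - l)"
    using assms unfolding closure_approachable dist_norm by (auto simp: not_less)
  then have nz: "\<phi> w - l \<noteq> 0" if "w \<in> disc" for w using that by force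
  have "cmod (1 / (\<phi> w - l)) \<le> 1 / d" if "w \<in> disc" for w
    using d(1) d(2)[OF that] by (simp add: norm_divide frac_le)
  then have "bounded ((\<lambda>w. 1 / (\<phi> w - l)) ` disc)" unfolding bounded_iff by blast
  then show psi: "bounded_holomorphic2 (\<lambda>p. 1 / (\<phi> (snd p) - l))"
    by (intro bounded_holomorphic2_snd[of "\<lambda>w. 1 / (\<phi> w - l)"] holomorphic_intros hol nz)
  \<comment> \<open>In this form every factor is visibly bounded, whereas z -
    \<open>\<phi>\<close>(w) may be unbounded on its own.\<close>
  have q: "bounded_holomorphic2 (\<lambda>p. (fst p - l) * (1 / (\<phi> (snd p) - l)) + (-1))"
    by (intro bounded_holomorphic2_add bounded_holomorphic2_mult psi bounded_holomorphic2_const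
        bounded_holomorphic2_fst_diff)
  \<comment> \<open>Restricted to the bidisc: outside it \<open>\<phi>\<close> may be 0 by
    convention, and for l = 0 the quotient 1 / 0 = 0 would break the identity.\<close>
  have eq: "(fst p - \<phi> (snd p)) * (1 / (\<phi> (snd p) - l)) = (fst p - l) * (1 / (\<phi> (snd p) - l)) + (-1)"
    if "p \<in> bidisc" for p
    using nz[of "snd p"] that by (auto simp: mem_Times_iff divide_simps)
  fix f assume f: "f \<in> hardy2"
  have "(fst p - l) * (1 / (\<phi> (snd p) - l)) * f p - f p =
      (fst p - \<phi> (snd p)) * (1 / (\<phi> (snd p) - l)) * f p" for p
  proof (cases "p \<in> bidisc")
    case True
    show ?thesis unfolding eq[OF True] by (simp only: distrib_right) simp
  qed (simp add: hardy2_vanishes[OF f])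
  then show "(\<lambda>p. (fst p - l) * (1 / (\<phi> (snd p) - l)) * f p - f p) \<in> M_space \<phi>"
    using bounded_multiple_in_M_space[OF psi bounded_holomorphic2_cong[OF q eq] f] by simp
qed

lemma closure_range_subset_spectrum:
  assumes l: "l \<in> closure (\<phi> ` disc \<inter> disc)"
  shows "l \<in> op_spectrum (N_space \<phi>) (S_z \<phi>)"
proof (rule ccontr)
  assume "l \<notin> op_spectrum (N_space \<phi>) (S_z \<phi>)"
  then obtain R where R: "bounded_op (N_space \<phi>) R"
    "\<And>f. f \<in> N_space \<phi> \<Longrightarrow> (\<lambda>p. S_z \<phi> (R f) p - l * R f p) = f"
    unfolding op_spectrum_def by blast
  then obtain C where C: "\<And>f. f \<in> N_space \<phi> \<Longrightarrow> h2_norm (R f) \<le> C * h2_norm f"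
    unfolding bounded_op_def by blast
  have RN: "f \<in> N_space \<phi> \<Longrightarrow> R f \<in> N_space \<phi>" for f
    using R(1) unfolding bounded_op_def by blast
  \<comment> \<open>This radius makes |\<open>\<phi> b\<close> - l| (|C| + 1) < 1, against the bound
    1 \<le> |\<open>\<phi> b\<close> - l| |C| derived below. The absolute value and the summand 1
    are there because nothing is known about the sign of C.\<close>
  have "1 / (\<bar>C\<bar> + 1) > 0" by simp
  then obtain m where m: "m \<in> \<phi> ` disc \<inter> disc" "dist m l < 1 / (\<bar>C\<bar> + 1)"
    using l unfolding closure_approachable by blast
  then obtain b where b: "b \<in> disc" "\<phi> b \<in> disc" "dist (\<phi> b) l < 1 / (\<bar>C\<bar> + 1)" by blast
  have q: "(\<phi> b, b) \<in> bidisc" using b by simp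
  define k where "k = hardy_kernel (\<phi> b, b)"
  have kH: "k \<in> hardy2" unfolding k_def by (rule hardy_kernel_in_hardy2[OF q])
  have eval: "h2_inner f k = f (\<phi> b, b)" if "f \<in> hardy2" for f
    unfolding k_def by (rule h2_inner_kernel[OF that q])
  have kN: "k \<in> N_space \<phi>"
    unfolding N_space_def
  proof (intro CollectI conjI ballI)
    fix g assume g: "g \<in> M_space \<phi>"
    show "h2_inner k g = 0"
      using h2_inner_commute[OF M_space_hardy2[OF g] kH] eval[OF M_space_hardy2[OF g]]
        M_space_vanishes[OF g b(1,2)] by simp
  qed (rule kH)
  note gN = RN[OF kN]
  have "k (\<phi> b, b) = S_z \<phi> (R k) (\<phi> b, b) - l * R k (\<phi> b, b)"
    using R(2)[OF kN] by metis
  \<comment> \<open>The error z (R k) - \<open>S_z\<close> (R k) lies in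
    \<open>M_space \<phi>\<close> and so vanishes at this point, where z equals
    \<open>\<phi> b\<close>; the compressed shift acts there as multiplication by
    \<open>\<phi> b\<close>.\<close>
  also have "\<dots> = (\<phi> b - l) * R k (\<phi> b, b)"
    using M_space_vanishes[OF S_z_N_space(2)[OF gN] b(1,2)] by (simp add: algebra_simps)
  finally have "(h2_norm k)\<^sup>2 = cmod (\<phi> b - l) * cmod (h2_inner (R k) k)"
    using eval[OF kH] h2_inner_self[OF kH] eval[OF N_space_hardy2[OF gN]]
    by (metis norm_mult norm_of_real abs_power2 abs_of_nonneg zero_le_power2)
  also have "\<dots> \<le> cmod (\<phi> b - l) * (\<bar>C\<bar> * h2_norm k * h2_norm k)"
  proof (rule mult_left_mono)
    have "cmod (h2_inner (R k) k) \<le> h2_norm (R k) * h2_norm k"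
      by (rule h2_Cauchy_Schwarz[OF N_space_hardy2[OF gN] kH])
    also have "\<dots> \<le> \<bar>C\<bar> * h2_norm k * h2_norm k"
      by (intro mult_right_mono order_trans[OF C[OF kN]] h2_norm_nonneg kH) auto
    finally show "cmod (h2_inner (R k) k) \<le> \<bar>C\<bar> * h2_norm k * h2_norm k" .
  qed simp
  finally have "(h2_norm k)\<^sup>2 * 1 \<le> (h2_norm k)\<^sup>2 * (cmod (\<phi> b - l) * \<bar>C\<bar>)"
    by (simp add: power2_eq_square mult_ac)
  moreover have "h2_norm k > 0" unfolding k_def by (rule hardy_kernel_norm_pos[OF q])
  ultimately have "1 \<le> cmod (\<phi> b - l) * \<bar>C\<bar>" by (simp del: mult_1_right)
  also have "\<dots> \<le> cmod (\<phi> b - l) * (\<bar>C\<bar> + 1)" by (intro mult_left_mono) auto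
  also have "\<dots> < 1" using b(3) by (simp add: dist_norm pos_less_divide_eq add_nonneg_pos)
  finally show False by simp
qed

end

theorem proposition3p1:
  fixes \<phi> :: "complex \<Rightarrow> complex"
  assumes "\<phi> \<in> hardy2_disc"
    and "\<phi> \<noteq> (\<lambda>_. 0)"
    and "\<phi> ` disc \<inter> disc \<noteq> {}"
  shows "closure (\<phi> ` disc \<inter> disc) \<subseteq> op_spectrum (N_space \<phi>) (S_z \<phi>)
    \<and> op_spectrum (N_space \<phi>) (S_z \<phi>) \<subseteq> closure (\<phi> ` disc) \<inter> closure disc"
proof (intro conjI subsetI IntI)
  fix l assume "l \<in> closure (\<phi> ` disc \<inter> disc)"
  then show "l \<in> op_spectrum (N_space \<phi>) (S_z \<phi>)"
    by (rule closure_range_subset_spectrum[OF assms(1)])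
next
  fix l assume l: "l \<in> op_spectrum (N_space \<phi>) (S_z \<phi>)"
  show "l \<in> closure (\<phi> ` disc)"
    using spectrum_subset_closure_range[OF assms(1)] l by blast
  have "cmod l \<le> 1"
    using spectrum_subset_closed_disc[OF assms(1), of l] l by (meson not_le)
  then show "l \<in> closure disc" by simp
qed

end
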